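(* Let $K=K_{[c_1,\dots,c_n]}$ be the two bridge knot associated to the ordered collection $(c_1,\dots,c_n)$ of nonzero integers and assume that $n$ is odd. Let $G$ be the Goeritz matrix of $K$ associated to its projection $D_{[c_1,\dots,c_n]}$. Then there is a matrix $P\in GL_N(\mathbb Q)$, where $N=|c_1|+|c_3|+\dots+|c_n|-1$, with $\det P=\pm1$ and such that $$P^{\tau}GP=\bigoplus_{i=1,3,5,\dots,n}\left(\bigoplus_{k=1}^{|c_i|-1}\left\langle-\epsilon_i\,\tfrac{k+1}{k}\right\rangle\right)\oplus\bigoplus_{i=2,4,\dots,n-1}\left\langle\frac{p_{i+1}}{c_{i+1}\,p_{i-1}}\right\rangle .$$ Here $\epsilon_i=\mathrm{Sign}(c_i)$ and $p_m$ is the numerator of the canonical representation of $[c_1,\dots,c_m]=\frac{p_m}{q_m}$, $m\le n$. Accordingly, the signature $\sigma(G)$ of the Goeritz matrix $G$ is given by $$\sigma(G)=\sum_{i=1,3,\dots,n}(\epsilon_i-c_i)+\sum_{i=2,4,\dots,n-1}\mathrm{Sign}\left(\frac{p_{i+1}}{c_{i+1}\,p_{i-1}}\right).$$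
   Context: Notation. $\langle a\rangle$ is the $1\times1$ matrix $(a)$; a direct sum of such blocks is the diagonal matrix with those entries; empty sums are omitted. $P^\tau$ is the transpose. $\sigma(G)$ is the number of positive minus the number of negative eigenvalues. $\mathrm{Sign}(x)$ is the sign of $x$. Continued fractions. $[c_1,\dots,c_n]=c_1-\cfrac{1}{c_2-\cfrac{1}{\ddots-\cfrac1{c_n}}}$. The canonical representation $p_n/q_n$ of $[c_1,\dots,c_n]$ is defined inductively: for $n=1$, $p_1=c_1$, $q_1=1$; for $n\ge2$, if $p',q'$ is the canonical representation of $[c_2,\dots,c_n]$, then $p_n=c_1p'-q'$ and $q_n=p'$. The diagram. For $n$ odd, $D_{[c_1,\dots,c_n]}$ is the standard two bridge (knot or link) diagram with $n$ twist regions, the $i$-th being a pair of parallel strands with $|c_i|$ half-twists, right-handed if $c_i>0$ and left-handed if $c_i<0$ (right-handed means that if both strands are oriented in the same direction along the twist, the crossings are positive). $K_{[c_1,\dots,c_n]}$ is the isotopy class of the knot/link it represents. Checkerboard colour the complementary regions with the unbounded region white. The white regions are $e^0$ (unbounded), $e^2,e^4,\dots,e^{n-1}$, and $e^i_1,\dots,e^i_{|c_i|-1}$ for each odd $i$. They form the vertices of a plane graph whose edges are the crossings: for each odd $i$ the $|c_i|$ crossings of the $i$-th twist region form a path $e^{i-1},e^i_1,\dots,e^i_{|c_i|-1},e^{i+1}$ (with the convention $e^{n+1}=e^0$), and for each even $i$ the $|c_i|$ crossings of the $i$-th twist region are parallel edges between $e^i$ and $e^0$. In the sphere, the paths for $i=1,3,\dots,n$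 together form a cycle through $e^0$ and all the parallel edges for even $i$ lie on the same side of this cycle. The diagram is recovered from this plane graph (as its medial diagram) together with the handedness of the twists. Goeritz matrix. Each crossing $p$ has a sign $\eta(p)=\pm1$ depending only on the over/under information and the colouring: orient the two strands at $p$ so that one white corner lies between the two outgoing ends and the other white corner between the two incoming ends; then $\eta(p)$ is minus the usual sign of the resulting oriented crossing. Thus every crossing of the $i$-th twist region of $D_{[c_1,\dots,c_n]}$ has $\eta=-\epsilon_i$ if $i$ is odd and $\eta=\epsilon_i$ if $i$ is even. On the free abelian group generated by all white regions define the symmetric bilinear form with matrix entries $g_{ab}=-\sum_p\eta(p)$ for $a\neq b$ (sum over the crossings $p$ joining the white regions $a$ and $b$) and $g_{aa}=-\sum_{b\neq a}g_{ab}$. The Goeritz form/matrix $G$ is the restriction of this form to the subgroup $\mathbb Z^N$ generated by all white regions except $e^0$, expressed in the basis of these white regions.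
   Formalization: The numerators p_{i-1} for even i with 2 ≤ i ≤ n-1 are assumed nonzero; otherwise the entry p_{i+1}/(c_{i+1}p_{i-1}) is undefined, e.g. for (2,1,2,1,1), where p_3 = 0. *)

theory Defs
  imports
    Complex_Main
    "Jordan_Normal_Form.Matrix"
    "Jordan_Normal_Form.Determinant"
    "Jordan_Normal_Form.Char_Poly"
begin

section \<open>Continued fractions\<close>

fun canonical_rep :: "int list \<Rightarrow> int \<times> int" where
  "canonical_rep [x] = (x, 1)"
| "canonical_rep (x # y # ys) = (let (p, q) = canonical_rep (y # ys) in (x * p - q, p))"

text \<open>A tuple \<open>(c\<^sub>1, \<dots>, c\<^sub>n)\<close> is a function \<open>c :: nat \<Rightarrow> int\<close> of which only the values at
  \<open>1, \<dots>, n\<close> matter; \<open>cf_numerator c m\<close> is \<open>p\<^sub>m\<close>, for \<open>m \<ge> 1\<close>.\<close>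

definition cf_numerator :: "(nat \<Rightarrow> int) \<Rightarrow> nat \<Rightarrow> int" where
  "cf_numerator c m = fst (canonical_rep (map c [1..<Suc m]))"

section \<open>Checkerboard coloured diagrams\<close>

text \<open>The four ends at a crossing are numbered \<open>0, 1, 2, 3\<close> counterclockwise, in such a way that one
  white corner lies between the ends \<open>0\<close> and \<open>1\<close> and the other one between \<open>2\<close> and \<open>3\<close>; the black
  corners lie between \<open>1\<close> and \<open>2\<close> and between \<open>3\<close> and \<open>0\<close>. One strand joins the ends \<open>0\<close> and \<open>2\<close>,
  the other one the ends \<open>1\<close> and \<open>3\<close>.\<close>

datatype strand = Strand02 | Strand13

fun end_strand :: "nat \<Rightarrow> strand" where
  "end_strand e = (if even e then Strand02 else Strand13)"

text \<open>The usual sign of an oriented crossing in terms of the end at which the over strand leaves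
  and the end at which the under strand leaves: a crossing is positive iff turning the direction of
  the over strand counterclockwise by a quarter turn gives the direction of the under strand.\<close>

definition crossing_sign :: "nat \<Rightarrow> nat \<Rightarrow> int" where
  "crossing_sign ov un = (if un = (ov + 1) mod 4 then 1 else -1)"

text \<open>The sign of the crossing whose over strand is \<open>s\<close>, when both strands are oriented such that
  the corner between the ends \<open>e\<close> and \<open>e + 1\<close> lies between the two outgoing ends.\<close>

definition sign_out_of_corner :: "strand \<Rightarrow> nat \<Rightarrow> int" where
  "sign_out_of_corner s e =
     (let e' = (e + 1) mod 4
      in if end_strand e = s then crossing_sign e e' else crossing_sign e' e)"

text \<open>A connected diagram on the sphere with a checkerboard colouring, given by the plane graph
  whose vertices are the white regions and whose edges are the crossings: \<open>corner x False\<close> and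
  \<open>corner x True\<close> are the white regions at the corners \<open>01\<close> and \<open>23\<close> of the crossing \<open>x\<close>, and
  \<open>rotation w\<close> lists, in counterclockwise cyclic order around the vertex \<open>w\<close>, the crossing corners
  that lie in the region \<open>w\<close>. This describes the embedding of the graph, of which the diagram is the
  medial diagram; \<open>over\<close> tells which strand is on top at each crossing.\<close>

record ('r, 'x) diagram =
  white_regions :: "'r set"
  unbounded :: 'r
  crossings :: "'x set"
  corner :: "'x \<Rightarrow> bool \<Rightarrow> 'r"
  rotation :: "'r \<Rightarrow> ('x \<times> bool) list"
  over :: "'x \<Rightarrow> strand"

section \<open>The Goeritz matrix\<close>

definition eta :: "('r, 'x) diagram \<Rightarrow> 'x \<Rightarrow> int" where
  "eta D x = - sign_out_of_corner (over D x) 0"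

lemma eta_other_corner: "eta D x = - sign_out_of_corner (over D x) 2"
  by (cases "over D x") (simp_all add: eta_def sign_out_of_corner_def crossing_sign_def Let_def)

definition crossings_joining :: "('r, 'x) diagram \<Rightarrow> 'r \<Rightarrow> 'r \<Rightarrow> 'x set" where
  "crossings_joining D a b = {x \<in> crossings D. {corner D x False, corner D x True} = {a, b}}"

definition goeritz_offdiag :: "('r, 'x) diagram \<Rightarrow> 'r \<Rightarrow> 'r \<Rightarrow> int" where
  "goeritz_offdiag D a b = - (\<Sum>x\<in>crossings_joining D a b. eta D x)"

definition goeritz_entry :: "('r, 'x) diagram \<Rightarrow> 'r \<Rightarrow> 'r \<Rightarrow> int" where
  "goeritz_entry D a b =
     (if a = b then - (\<Sum>d\<in>white_regions D - {a}. goeritz_offdiag D a d)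
      else goeritz_offdiag D a b)"

text \<open>The basis consisting of the white regions other than the unbounded one comes without a
  preferred order, so the Goeritz matrix is taken with respect to an enumeration \<open>ws\<close> of them.\<close>

definition goeritz_basis :: "('r, 'x) diagram \<Rightarrow> 'r list \<Rightarrow> bool" where
  "goeritz_basis D ws \<longleftrightarrow> distinct ws \<and> set ws = white_regions D - {unbounded D}"

definition goeritz_matrix :: "('r, 'x) diagram \<Rightarrow> 'r list \<Rightarrow> int mat" where
  "goeritz_matrix D ws =
     mat (length ws) (length ws) (\<lambda>(r, s). goeritz_entry D (ws ! r) (ws ! s))"

section \<open>Two bridge diagrams\<close>

text \<open>\<open>E i\<close> is \<open>e\<^sup>i\<close> for even \<open>i\<close>, and \<open>B i j\<close> is the bigon \<open>e\<^sup>i\<^sub>j\<close> for odd \<open>i\<close>. The crossing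
  \<open>(i, j)\<close> is the \<open>j\<close>-th one, \<open>1 \<le> j \<le> \<bar>c\<^sub>i\<bar>\<close>, of the \<open>i\<close>-th twist region.\<close>

datatype region = E nat | B nat nat

definition twist_path :: "(nat \<Rightarrow> int) \<Rightarrow> nat \<Rightarrow> nat \<Rightarrow> nat \<Rightarrow> region" where
  "twist_path c n i j =
     (if j = 0 then E (i - 1)
      else if j < nat \<bar>c i\<bar> then B i j
      else if i = n then E 0
      else E (i + 1))"

text \<open>In an odd twist region the twist runs at each crossing from one white corner to the
  other one, in an even twist region from one black corner to the other one. A twist region is
  right-handed iff its crossings are positive when both strands are oriented along the twist, that
  is, out of the corner \<open>01\<close> (odd \<open>i\<close>) or out of the corner \<open>12\<close> (even \<open>i\<close>).\<close>

definition twist_over :: "(nat \<Rightarrow> int) \<Rightarrow> nat \<Rightarrow> strand" where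
  "twist_over c i =
     (THE s. sign_out_of_corner s (if odd i then 0 else 1) = sgn (c i))"

text \<open>The paths for odd \<open>i\<close> form a cycle, which starts at \<open>e\<^sup>0\<close> and has all edges for even \<open>i\<close> on its
  left; parallel edges appear in opposite orders around their two end points.\<close>

fun two_bridge_rotation :: "(nat \<Rightarrow> int) \<Rightarrow> nat \<Rightarrow> region \<Rightarrow> ((nat \<times> nat) \<times> bool) list" where
  "two_bridge_rotation c n (B i j) = [((i, j + 1), False), ((i, j), True)]"
| "two_bridge_rotation c n (E i) =
     (if i = 0 then
        [((1, 1), False)]
        @ concat (map (\<lambda>k. map (\<lambda>j. ((k, j), True)) (rev [1..<Suc (nat \<bar>c k\<bar>)]))
                      (filter even [2..<n]))
        @ [((n, nat \<bar>c n\<bar>), True)]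
      else
        [((i + 1, 1), False)]
        @ map (\<lambda>j. ((i, j), False)) [1..<Suc (nat \<bar>c i\<bar>)]
        @ [((i - 1, nat \<bar>c (i - 1)\<bar>), True)])"

definition two_bridge_diagram :: "(nat \<Rightarrow> int) \<Rightarrow> nat \<Rightarrow> (region, nat \<times> nat) diagram" where
  "two_bridge_diagram c n = \<lparr>
     white_regions = {E i | i. even i \<and> i < n} \<union>
                     {B i j | i j. odd i \<and> i \<le> n \<and> 1 \<le> j \<and> j < nat \<bar>c i\<bar>},
     unbounded = E 0,
     crossings = {(i, j). 1 \<le> i \<and> i \<le> n \<and> 1 \<le> j \<and> j \<le> nat \<bar>c i\<bar>},
     corner = (\<lambda>(i, j) second.
       if odd i then twist_path c n i (if second then j else j - 1)
       else if second then E 0 else E i),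
     rotation = two_bridge_rotation c n,
     over = (\<lambda>(i, j). twist_over c i) \<rparr>"

lemma sign_out_of_corner_simps [simp]:
  "sign_out_of_corner Strand02 0 = 1" "sign_out_of_corner Strand13 0 = -1"
  "sign_out_of_corner Strand02 (Suc 0) = -1" "sign_out_of_corner Strand13 (Suc 0) = 1"
  by (simp_all add: sign_out_of_corner_def crossing_sign_def Let_def)

lemma twist_over_eq:
  assumes "c i \<noteq> 0"
  shows "twist_over c i = (if odd i \<longleftrightarrow> c i > 0 then Strand02 else Strand13)"
  unfolding twist_over_def
proof (rule the_equality)
  show "sign_out_of_corner (if odd i \<longleftrightarrow> c i > 0 then Strand02 else Strand13)
          (if odd i then 0 else 1) = sgn (c i)"
    using assms by (auto simp: sgn_if)
next
  fix s
  assume "sign_out_of_corner s (if odd i then 0 else 1) = sgn (c i)"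
  then show "s = (if odd i \<longleftrightarrow> c i > 0 then Strand02 else Strand13)"
    using assms by (cases s) (auto simp: sgn_if split: if_splits)
qed

lemma eta_two_bridge:
  assumes "c i \<noteq> 0"
  shows "eta (two_bridge_diagram c n) (i, j) = (if odd i then - sgn (c i) else sgn (c i))"
  using assms by (auto simp: eta_def two_bridge_diagram_def twist_over_eq sgn_if)

section \<open>Direct sums and the signature\<close>

definition block1 :: "'a \<Rightarrow> 'a mat" where
  "block1 a = mat 1 1 (\<lambda>_. a)"

text \<open>Eigenvalues are counted with their multiplicity as roots of the characteristic polynomial.\<close>

definition matrix_signature :: "real mat \<Rightarrow> int" where
  "matrix_signature A =
     (\<Sum>x | eigenvalue A x \<and> 0 < x. int (Polynomial.order x (char_poly A))) -
     (\<Sum>x | eigenvalue A x \<and> x < 0. int (Polynomial.order x (char_poly A)))"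

end

theory Submission
  imports Defs "Jordan_Normal_Form.Schur_Decomposition"
begin

text \<open>
  Since \<open>g\<^sub>a\<^sub>b\<close> is minus the sum of the signs of the crossings joining \<open>a\<close> and \<open>b\<close>, and the rows of
  \<open>g\<close> sum to zero, the Goeritz form is a weighted graph Laplacian: on functions \<open>\<phi>\<close>, \<open>\<psi>\<close> on the
  white regions that vanish on \<open>e\<^sup>0\<close> it is the sum over all crossings \<open>x\<close> of
  \<open>\<eta>(x) \<cdot> \<Delta>\<^sub>x\<phi> \<cdot> \<Delta>\<^sub>x\<psi>\<close>, where \<open>\<Delta>\<^sub>x\<close> is the difference of the values at the two ends of \<open>x\<close>
  (\<open>goeritz_form_eq_sum_crossings\<close>). This is the energy of an electrical network earthed at \<open>e\<^sup>0\<close>, whose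
  conductances \<open>\<eta>(x)\<close> may be negative, and the theorem asks for a basis that is orthogonal for it.

  All crossings of one odd twist region have the same conductance. Hence a function that is affine along
  each path has constant differences there, and it is orthogonal to every function supported
  in the interior of a path, the differences of the latter having sum zero. So the two kinds of functions
  can be treated separately.

  Inside the \<open>i\<close>-th path, Gram-Schmidt along \<open>e\<^sup>i\<^sub>1, e\<^sup>i\<^sub>2, \<dots>\<close> gives the ramps that rise as
  \<open>1/k, 2/k, \<dots>, k/k\<close> and then drop to \<open>0\<close>. The squares of the differences have sum
  \<open>k \<cdot> (1/k)\<^sup>2 + 1 = (k + 1)/k\<close>, and the conductance is \<open>-\<epsilon>\<^sub>i\<close>.

  An affine function is determined by its values on \<open>e\<^sup>2, e\<^sup>4, \<dots>\<close>. Gram-Schmidt in this order gives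
  functions that vanish beyond some \<open>e\<^sup>t\<close> and have no net current at the nodes before \<open>e\<^sup>t\<close>. Starting at the
  earthed \<open>e\<^sup>0\<close>, the laws of Ohm and Kirchhoff determine potentials and currents alternately, up to a
  common factor, and the recursion is the one of the numerators of the continued fractions
  (\<open>potential_ohm\<close>, \<open>potential_kirchhoff\<close>): up to sign \<open>p\<^bsub>l-1\<^esub>\<close> is the potential at \<open>e\<^sup>l\<close> for even \<open>l\<close>, and
  the current in the \<open>l\<close>-th path for odd \<open>l\<close>. The energy is the net current at \<open>e\<^sup>t\<close> divided by the
  potential there, which is \<open>p\<^bsub>t+1\<^esub> / (c\<^bsub>t+1\<^esub> p\<^bsub>t-1\<^esub>)\<close> (\<open>form_of_potential_modes\<close>).

  The change of basis is unitriangular when the bigons come first and then \<open>e\<^sup>2, e\<^sup>4, \<dots>\<close>. For another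
  enumeration of the regions its rows are permuted, so that its determinant is \<open>\<plusminus>1\<close>.

  The construction works over every field of characteristic zero. Over the reals it gives the signature, by
  the orthogonal diagonalization of symmetric matrices and the law of inertia
  (\<open>signature_of_congruent_diagonal\<close>).
\<close>

section \<open>Diagonal matrices and congruence\<close>

text \<open>Written as a direct sum of blocks of size one, a diagonal matrix splits off its first entry by the
  defining equation of \<open>diag_block_mat\<close>.\<close>
abbreviation diagonal_of :: "'a::zero list \<Rightarrow> 'a mat" where
  "diagonal_of ds \<equiv> diag_block_mat (map block1 ds)"

lemma block1_simps [simp]:
  "dim_row (block1 a) = 1" "dim_col (block1 a) = 1" "block1 a $$ (0, 0) = a"
  by (simp_all add: block1_def)

lemma dim_diagonal_of [simp]:
  "dim_row (diagonal_of ds) = length ds" "dim_col (diagonal_of ds) = length ds"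
  by (induction ds) (simp_all add: Let_def)

lemma diagonal_of_carrier [simp]: "diagonal_of ds \<in> carrier_mat (length ds) (length ds)"
  by (rule carrier_matI) simp_all

lemma index_diagonal_of:
  "i < length ds \<Longrightarrow> j < length ds \<Longrightarrow> diagonal_of ds $$ (i, j) = (if i = j then ds ! i else 0)"
proof (induction ds arbitrary: i j)
  case (Cons d ds)
  then show ?case by (cases i; cases j) (auto simp: Let_def)
qed simp

lemma diagonal_of_eqI:
  assumes "M \<in> carrier_mat (length ds) (length ds)"
    and "\<And>i j. i < length ds \<Longrightarrow> j < length ds \<Longrightarrow> M $$ (i, j) = (if i = j then ds ! i else 0)"
  shows "M = diagonal_of ds"
  by (rule eq_matI) (use assms in \<open>auto simp: index_diagonal_of\<close>)

lemma congruence_entry: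
  fixes M P :: "'a::comm_semiring_0 mat"
  assumes "P \<in> carrier_mat n n" "M \<in> carrier_mat n n" "s < n" "t < n"
  shows "(transpose_mat P * M * P) $$ (s, t) = (\<Sum>r<n. \<Sum>q<n. P $$ (r, s) * M $$ (r, q) * P $$ (q, t))"
  using assms by (simp add: scalar_prod_def atLeast0LessThan sum_distrib_left mult.assoc)

text \<open>With rows and columns in the same order the matrix is upper triangular with ones on the diagonal.
  Another order of the rows contributes the sign of a permutation.\<close>
lemma det_of_unitriangular_family:
  fixes f :: "'b \<Rightarrow> 'b \<Rightarrow> 'a::comm_ring_1"
  assumes dist: "distinct ws" "distinct bs" and set: "set ws = set bs"
    and tri: "sorted_wrt (\<lambda>a b. f a b = 0) bs" and diag: "\<And>a. a \<in> set bs \<Longrightarrow> f a a = 1"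
  defines "n \<equiv> length bs"
  shows "det (mat n n (\<lambda>(r, s). f (bs ! s) (ws ! r))) \<in> {1, -1}"
proof -
  have "mset ws = mset bs" using dist set by (simp add: set_eq_iff_mset_eq_distinct)
  then obtain p where p: "p permutes {..<n}" and ws: "permute_list p bs = ws"
    unfolding n_def by (rule mset_eq_permutation)
  define U where "U = mat n n (\<lambda>(r, s). f (bs ! s) (bs ! r))"
  have U: "U \<in> carrier_mat n n" by (simp add: U_def)
  have "upper_triangular U"
    using tri by (auto simp: U_def n_def sorted_wrt_iff_nth_less)
  moreover have "diag_mat U = replicate n 1"
    by (rule nth_equalityI) (auto simp: diag_mat_def U_def n_def diag)
  ultimately have "det U = 1"
    using det_upper_triangular[OF _ U] by simp
  moreover have "mat n n (\<lambda>(r, s). f (bs ! s) (ws ! r)) = mat n n (\<lambda>(r, s). U $$ (p r, s))"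
    using p permutes_in_image[OF p]
    by (intro eq_matI) (auto simp: U_def n_def permute_list_nth simp flip: ws)
  moreover have "p permutes {0..<n}" using p by (simp add: atLeast0LessThan)
  ultimately show ?thesis
    using det_permute_rows[OF U, of p] by (auto simp: sign_def)
qed

section \<open>Orthogonal diagonalization, the law of inertia and the signature\<close>

lemma char_poly_diagonal_of:
  fixes ds :: "'a::field list"
  shows "char_poly (diagonal_of ds) = (\<Prod>d\<leftarrow>ds. [:- d, 1:])"
proof -
  have "upper_triangular (diagonal_of ds)"
    by (auto simp: index_diagonal_of)
  moreover have "diag_mat (diagonal_of ds) = ds"
    by (rule nth_equalityI) (auto simp: diag_mat_def index_diagonal_of)
  ultimately show ?thesis
    using char_poly_upper_triangular[OF diagonal_of_carrier[of ds]] by metis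
qed

lemma order_prod_linear:
  fixes es :: "'a::idom list"
  shows "Polynomial.order x (\<Prod>e\<leftarrow>es. [:- e, 1:]) = count_list es x"
proof (induction es)
  case (Cons e es)
  have nz: "(\<Prod>e\<leftarrow>es. [:- e, 1:]) \<noteq> 0"
    by (auto simp: prod_list_zero_iff)
  have "Polynomial.order x [:- e, 1:] = (if e = x then 1 else 0)"
    using order_linear_power[of x "- e" 1] by auto
  moreover have "[:- e, 1:] * (\<Prod>e\<leftarrow>es. [:- e, 1:]) \<noteq> 0"
    unfolding mult_eq_0_iff using nz by simp
  ultimately show ?case
    using Cons by (simp add: order_mult del: mult_pCons_left)
qed (simp add: order_0I)

lemma matrix_signature_of_roots:
  assumes A: "A \<in> carrier_mat n n"
    and cp: "char_poly A = (\<Prod>e\<leftarrow>es. [:- e, 1:])"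
  shows "matrix_signature A = int (length (filter ((<) 0) es)) - int (length (filter (\<lambda>e. e < 0) es))"
proof -
  have ev: "eigenvalue A x \<longleftrightarrow> x \<in> set es" for x
    by (auto simp: eigenvalue_root_char_poly[OF A] cp poly_prod_list prod_list_zero_iff)
  have "(\<Sum>x | eigenvalue A x \<and> Q x. int (Polynomial.order x (char_poly A))) = int (length (filter Q es))" for Q
  proof -
    have "(\<Sum>x | eigenvalue A x \<and> Q x. int (Polynomial.order x (char_poly A))) =
          int (\<Sum>x\<in>set (filter Q es). count_list (filter Q es) x)"
      unfolding cp order_prod_linear ev of_nat_sum
      by (rule sum.cong) (auto simp: count_list_eq_length_filter intro!: arg_cong[of _ _ length] filter_cong)
    then show ?thesis by (simp add: sum_count_set)
  qed
  then show ?thesis by (simp add: matrix_signature_def)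
qed

text \<open>A complex eigenvalue \<open>z\<close> exists since \<open>\<complex>\<close> is algebraically closed. Moving \<open>A\<close> from one side
  of the hermitian product \<open>\<langle>v, v\<rangle>\<close> of an eigenvector to the other changes \<open>z\<close> into its conjugate, so
  \<open>z\<close> is real, and it is a root of the real characteristic polynomial.\<close>
lemma symmetric_real_eigenvalue_exists:
  fixes A :: "real mat"
  assumes A: "A \<in> carrier_mat n n" and sym: "transpose_mat A = A" and n: "n > 0"
  obtains e where "eigenvalue A e"
proof -
  let ?C = "map_mat complex_of_real A"
  have C: "?C \<in> carrier_mat n n" using A by simp
  obtain as where as: "char_poly ?C = (\<Prod>a\<leftarrow>as. [:- a, 1:])" "length as = n"
    using char_poly_factorized[OF C] by blast
  then obtain z where "z \<in> set as" using n by (cases as) auto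
  then have root: "poly (char_poly ?C) z = 0"
    by (simp add: as poly_prod_list prod_list_zero_iff)
  then have "eigenvalue ?C z" by (simp add: eigenvalue_root_char_poly[OF C])
  then obtain v where v: "v \<in> carrier_vec n" "v \<noteq> 0\<^sub>v n" and Av: "?C *\<^sub>v v = z \<cdot>\<^sub>v v"
    using A by (auto simp: eigenvalue_def eigenvector_def)
  have cv: "conjugate v \<in> carrier_vec n" using v by simp
  have Acv: "?C *\<^sub>v conjugate v = cnj z \<cdot>\<^sub>v conjugate v"
  proof -
    have "?C *\<^sub>v conjugate v = conjugate (?C *\<^sub>v v)"
      using A v by (intro eq_vecI) (auto simp: scalar_prod_def conjugate_complex_def sum_conjugate)
    then show ?thesis by (simp add: Av conjugate_smult_vec conjugate_complex_def)
  qed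
  have tr: "transpose_mat ?C = ?C" by (simp add: map_mat_transpose sym)
  have "z * (v \<bullet>c v) = (?C *\<^sub>v v) \<bullet> conjugate v"
    using v cv by (simp add: Av)
  also have "\<dots> = v \<bullet> (?C *\<^sub>v conjugate v)"
    using transpose_vec_mult_scalar[OF C cv v(1)] tr v
    by (metis C comm_scalar_prod cv mult_mat_vec_carrier transpose_vec_mult_scalar)
  also have "\<dots> = cnj z * (v \<bullet>c v)"
    using v cv by (simp add: Acv)
  finally have "z = cnj z" using v by simp
  then have "z = complex_of_real (Re z)" by (metis complex_cnj_cancel_iff Reals_cnj_iff of_real_Re)
  then have "complex_of_real (poly (char_poly A) (Re z)) = 0"
    using root of_real_hom.char_poly_hom[OF A, where 'a = complex] by (metis of_real_hom.poly_map_poly)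
  then have "eigenvalue A (Re z)" by (simp add: eigenvalue_root_char_poly[OF A])
  then show ?thesis by (rule that)
qed

text \<open>The vector is completed to a basis, on which Gram-Schmidt keeps the first vector; then all vectors
  are normalized.\<close>
lemma orthonormal_completion:
  fixes v :: "real vec"
  assumes v: "v \<in> carrier_vec n" "v \<noteq> 0\<^sub>v n"
  obtains W a where "W \<in> carrier_mat n n" "transpose_mat W * W = 1\<^sub>m n" "col W 0 = a \<cdot>\<^sub>v v"
proof -
  interpret cof_vec_space n "TYPE(real)" .
  define b where "b = basis_completion v"
  define ws where "ws = gram_schmidt n b"
  note b = basis_completion[OF v, folded b_def]
  note gs = gram_schmidt_result[OF b(2,4,5) ws_def]
  have n: "n > 0" using v by (cases n) auto
  have hd: "ws ! 0 = v"
  proof -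
    obtain bs where "b = v # bs" using b(6,7) n by (cases b) auto
    then have "hd ws = v" unfolding ws_def using v by simp
    then show ?thesis using gs(4) b(6) n by (cases ws) auto
  qed
  have len: "length ws = n" using gs b by simp
  have wc: "ws ! i \<in> carrier_vec n" if "i < n" for i using gs(3) len that by auto
  have orth: "ws ! i \<bullet> ws ! j = 0 \<longleftrightarrow> i \<noteq> j" if "i < n" "j < n" for i j
    using corthogonalD[OF gs(2), of i j] that len by simp
  define u where "u i = (1 / sqrt (ws ! i \<bullet> ws ! i)) \<cdot>\<^sub>v (ws ! i)" for i
  define W where "W = mat_of_cols n (map u [0..<n])"
  have W: "W \<in> carrier_mat n n"
    using mat_of_cols_carrier(1)[of n "map u [0..<n]"] by (simp add: W_def)
  have uc: "u i \<in> carrier_vec n" if "i < n" for i using wc[OF that] by (simp add: u_def)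
  have col: "col W i = u i" if "i < n" for i
    using that uc by (simp add: W_def)
  have "transpose_mat W * W = 1\<^sub>m n"
  proof (rule eq_matI)
    fix i j assume "i < dim_row (1\<^sub>m n :: real mat)" "j < dim_col (1\<^sub>m n :: real mat)"
    then have ij: "i < n" "j < n" by auto
    have "ws ! i \<bullet> ws ! i \<ge> 0" by (simp add: scalar_prod_def sum_nonneg)
    then have "u i \<bullet> u j = (if i = j then 1 else 0)"
      using carrier_vecD[OF wc[OF ij(1)]] carrier_vecD[OF wc[OF ij(2)]] ij orth[OF ij] orth[of i i]
      by (auto simp: u_def)
    then show "(transpose_mat W * W) $$ (i, j) = 1\<^sub>m n $$ (i, j)"
      using ij W by (simp add: col)
  qed (use W in auto)
  moreover have "col W 0 = (1 / sqrt (v \<bullet> v)) \<cdot>\<^sub>v v" using n by (simp add: col u_def hd)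
  ultimately show ?thesis using W that by blast
qed

text \<open>An orthogonal matrix \<open>W\<close> whose first column is an eigenvector turns \<open>A\<close> into a symmetric matrix
  whose first column is a multiple of the first unit vector. By symmetry the first row is, too, so that
  this matrix is a direct sum of the eigenvalue and a smaller symmetric matrix.\<close>
lemma orthogonal_diagonalization:
  fixes A :: "real mat"
  assumes "A \<in> carrier_mat n n" "transpose_mat A = A"
  shows "\<exists>Q es. length es = n \<and> Q \<in> carrier_mat n n \<and> transpose_mat Q * Q = 1\<^sub>m n \<and>
           transpose_mat Q * A * Q = diagonal_of es"
  using assms
proof (induction n arbitrary: A)
  case 0
  then show ?case
    by (intro exI[of _ "1\<^sub>m 0"] exI[of _ "[]"]) auto
next
  case (Suc m)
  let ?n = "Suc m"
  note A = Suc.prems(1)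
  obtain e where "eigenvalue A e"
    using symmetric_real_eigenvalue_exists[OF Suc.prems] by blast
  then obtain v where v: "v \<in> carrier_vec ?n" "v \<noteq> 0\<^sub>v ?n" and Av: "A *\<^sub>v v = e \<cdot>\<^sub>v v"
    using A by (auto simp: eigenvalue_def eigenvector_def)
  obtain W a where W: "W \<in> carrier_mat ?n ?n" and orthW: "transpose_mat W * W = 1\<^sub>m ?n"
    and colW: "col W 0 = a \<cdot>\<^sub>v v"
    using orthonormal_completion[OF v] by blast
  have WT: "transpose_mat W \<in> carrier_mat ?n ?n" using W by simp
  define M where "M = transpose_mat W * A * W"
  have M: "M \<in> carrier_mat ?n ?n" using W A by (simp add: M_def)
  have symM: "transpose_mat M = M"
    using W A WT Suc.prems(2)
    by (simp add: M_def transpose_mult[of _ ?n ?n _ ?n] assoc_mult_mat[of _ ?n ?n _ ?n _ ?n])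
  have "A *\<^sub>v col W 0 = e \<cdot>\<^sub>v col W 0"
    using v A Av by (simp add: colW mult_mat_vec smult_smult_assoc mult.commute)
  moreover have "transpose_mat W *\<^sub>v (e \<cdot>\<^sub>v col W 0) = e \<cdot>\<^sub>v (transpose_mat W *\<^sub>v col W 0)"
    by (rule mult_mat_vec[OF WT]) (use W in \<open>simp add: carrier_vecI\<close>)
  moreover have "col M 0 = transpose_mat W *\<^sub>v (A *\<^sub>v col W 0)"
    unfolding M_def assoc_mult_mat[OF WT A W]
    using W A WT by (simp only: col_mult2[OF WT mult_carrier_mat[OF A W]] col_mult2[OF A W] zero_less_Suc)
  ultimately have "col M 0 = e \<cdot>\<^sub>v (transpose_mat W *\<^sub>v col W 0)" by simp
  also have "transpose_mat W *\<^sub>v col W 0 = col (1\<^sub>m ?n) 0"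
    using W WT orthW by (metis col_mult2 zero_less_Suc)
  finally have colM: "M $$ (i, 0) = (if i = 0 then e else 0)" if "i < ?n" for i
    using that M by (auto simp: vec_eq_iff dest!: spec[of _ i])
  have rowM: "M $$ (0, i) = (if i = 0 then e else 0)" if "i < ?n" for i
    using colM[OF that] symM M that by (metis carrier_matD index_transpose_mat(1) zero_less_Suc)
  define A' where "A' = mat m m (\<lambda>(i, j). M $$ (Suc i, Suc j))"
  have A': "A' \<in> carrier_mat m m" by (simp add: A'_def)
  have "transpose_mat A' = A'"
  proof (rule eq_matI)
    fix i j assume "i < dim_row A'" "j < dim_col A'"
    then have "i < m" "j < m" by (auto simp: A'_def)
    then show "transpose_mat A' $$ (i, j) = A' $$ (i, j)"
      using symM M by (simp add: A'_def) (metis Suc_less_eq carrier_matD index_transpose_mat(1))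
  qed (auto simp: A'_def)
  then obtain Q' es where Q': "length es = m" "Q' \<in> carrier_mat m m"
    and orthQ': "transpose_mat Q' * Q' = 1\<^sub>m m"
    and diagQ': "transpose_mat Q' * A' * Q' = diagonal_of es"
    using Suc.IH[OF A'] by blast
  have Mblock: "M = four_block_mat (block1 e) (0\<^sub>m 1 m) (0\<^sub>m m 1) A'"
  proof (rule eq_matI)
    fix i j assume "i < dim_row (four_block_mat (block1 e) (0\<^sub>m 1 m) (0\<^sub>m m 1) A')"
      "j < dim_col (four_block_mat (block1 e) (0\<^sub>m 1 m) (0\<^sub>m m 1) A')"
    then have "i < ?n" "j < ?n" using A' by auto
    then show "M $$ (i, j) = four_block_mat (block1 e) (0\<^sub>m 1 m) (0\<^sub>m m 1) A' $$ (i, j)"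
      using A' by (cases i; cases j) (auto simp: colM rowM A'_def)
  qed (use M A' in auto)
  define R where "R = four_block_mat (1\<^sub>m 1) (0\<^sub>m 1 m) (0\<^sub>m m 1) Q'"
  have R: "R \<in> carrier_mat ?n ?n"
    using four_block_carrier_mat[of "1\<^sub>m 1" 1 1 Q' m m] Q' by (simp add: R_def)
  have RT: "transpose_mat R = four_block_mat (1\<^sub>m 1) (0\<^sub>m 1 m) (0\<^sub>m m 1) (transpose_mat Q')"
    using Q' by (simp add: R_def transpose_four_block_mat[of _ 1 1 _ m _ m])
  have b1: "block1 e \<in> carrier_mat 1 1" by (rule carrier_matI) simp_all
  have es: "diagonal_of es \<in> carrier_mat m m" using Q'(1) diagonal_of_carrier[of es] by simp
  have orthR: "transpose_mat R * R = 1\<^sub>m ?n"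
    unfolding RT unfolding R_def using Q' orthQ'
    by (subst mult_four_block_mat[of _ 1 1 _ m _ m _ _ 1 _ m])
       (auto simp: four_block_one_mat[of 1 m, simplified])
  have diagR: "transpose_mat R * M * R = diagonal_of (e # es)"
    unfolding RT Mblock unfolding R_def using Q' A' b1 diagQ'
    by (simp add: mult_four_block_mat[of _ 1 1 _ m _ m _ _ 1 _ m] Let_def left_add_zero_mat[OF es])
  have RTc: "transpose_mat R \<in> carrier_mat ?n ?n" using R by simp
  have "transpose_mat (W * R) * (W * R) = transpose_mat R * (transpose_mat W * W) * R"
    using W R WT RTc by (simp add: transpose_mult[of _ ?n ?n _ ?n] assoc_mult_mat[of _ ?n ?n _ ?n _ ?n])
  also have "\<dots> = 1\<^sub>m ?n" using orthW orthR RTc by simp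
  finally have 1: "transpose_mat (W * R) * (W * R) = 1\<^sub>m ?n" .
  have 2: "transpose_mat (W * R) * A * (W * R) = diagonal_of (e # es)"
    using W R A WT RTc diagR
    by (simp add: M_def transpose_mult[of _ ?n ?n _ ?n] assoc_mult_mat[of _ ?n ?n _ ?n _ ?n])
  show ?case
    by (intro exI[of _ "W * R"] exI[of _ "e # es"]) (use 1 2 W R Q' in auto)
qed

text \<open>Padding with zero vectors turns the given vectors into the rows of a singular square matrix.\<close>
lemma nonzero_vector_orthogonal_to_few:
  fixes vs :: "'a::field vec list"
  assumes "set vs \<subseteq> carrier_vec n" "length vs < n"
  obtains x where "x \<in> carrier_vec n" "x \<noteq> 0\<^sub>v n" "\<And>v. v \<in> set vs \<Longrightarrow> v \<bullet> x = 0"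
proof -
  define r where "r i = (if i < length vs then vs ! i else 0\<^sub>v n)" for i
  have rc: "r i \<in> carrier_vec n" for i using assms by (auto simp: r_def)
  define M where "M = mat\<^sub>r n n (\<lambda>i. if i = length vs then 0\<^sub>v n else r i)"
  have M: "M \<in> carrier_mat n n" by (simp add: M_def)
  have "det M = 0"
    unfolding M_def by (rule det_row_0) (use assms rc in auto)
  then obtain x where x: "x \<in> carrier_vec n" "x \<noteq> 0\<^sub>v n" "M *\<^sub>v x = 0\<^sub>v n"
    using det_0_iff_vec_prod_zero[OF M] by blast
  have "v \<bullet> x = 0" if "v \<in> set vs" for v
  proof -
    obtain i where i: "i < length vs" "vs ! i = v" using \<open>v \<in> set vs\<close> by (auto simp: in_set_conv_nth)
    have "(M *\<^sub>v x) $ i = row M i \<bullet> x" using i assms M by simp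
    also have "row M i = v"
      using i assms rc[of i] by (simp add: M_def r_def row_mat_of_row_fun)
    finally show ?thesis using x i assms by simp
  qed
  then show ?thesis using x that by blast
qed

lemma diagonal_of_form:
  fixes ds :: "'a::comm_ring_1 list"
  assumes x: "x \<in> carrier_vec (length ds)"
  shows "x \<bullet> (diagonal_of ds *\<^sub>v x) = (\<Sum>i<length ds. ds ! i * (x $ i)\<^sup>2)"
proof -
  have "(diagonal_of ds *\<^sub>v x) $ i = ds ! i * x $ i" if "i < length ds" for i
  proof -
    have "(diagonal_of ds *\<^sub>v x) $ i = (\<Sum>j<length ds. diagonal_of ds $$ (i, j) * x $ j)"
      using that x by (simp add: scalar_prod_def atLeast0LessThan)
    also have "\<dots> = (\<Sum>j<length ds. if j = i then ds ! i * x $ i else 0)"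
      by (rule sum.cong) (use that in \<open>auto simp: index_diagonal_of\<close>)
    finally show ?thesis using that by simp
  qed
  then show ?thesis
    using x by (auto simp: scalar_prod_def atLeast0LessThan power2_eq_square ac_simps intro!: sum.cong)
qed

text \<open>Otherwise there are fewer than \<open>n\<close> linear conditions in total in requiring that \<open>x = R y\<close> vanishes
  where \<open>ds\<close> is not positive and that \<open>y\<close> vanishes where \<open>es\<close> is positive. A nonzero solution gives the
  form, which has the same value on both sides, a positive value in the coordinates \<open>x\<close> and a
  value \<open>\<le> 0\<close> in the coordinates \<open>y\<close>.\<close>
lemma inertia_le:
  fixes ds es :: "real list"
  assumes len: "length ds = n" "length es = n"
    and R: "R \<in> carrier_mat n n" and S: "S \<in> carrier_mat n n" and RS: "R * S = 1\<^sub>m n"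
    and congr: "transpose_mat R * diagonal_of ds * R = diagonal_of es"
  shows "length (filter ((<) 0) ds) \<le> length (filter ((<) 0) es)"
proof (rule ccontr)
  assume less: "\<not> ?thesis"
  define I where "I = filter (\<lambda>i. \<not> 0 < ds ! i) [0..<n]"
  define J where "J = filter (\<lambda>j. 0 < es ! j) [0..<n]"
  define vs where "vs = map (unit_vec n) I @ map (row S) J"
  have *: "length (filter P xs) = length (filter (\<lambda>i. P (xs ! i)) [0..<length xs])"
    for P and xs :: "real list"
    by (subst (1) map_nth[symmetric, of xs], subst filter_map) (simp add: comp_def del: map_nth)
  have "length (filter ((<) 0) ds) + length I = n"
    using sum_length_filter_compl[of "\<lambda>i. 0 < ds ! i" "[0..<n]"] *[of "(<) 0" ds] len
    by (simp add: I_def)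
  moreover have "length (filter ((<) 0) es) = length J"
    using *[of "(<) 0" es] len by (simp add: J_def)
  ultimately have "length vs < n" using less by (simp add: vs_def)
  moreover have "set vs \<subseteq> carrier_vec n" using S by (auto simp: vs_def)
  ultimately obtain x where x: "x \<in> carrier_vec n" "x \<noteq> 0\<^sub>v n"
    and orth: "\<And>v. v \<in> set vs \<Longrightarrow> v \<bullet> x = 0"
    using nonzero_vector_orthogonal_to_few by blast
  have x0: "x $ i = 0" if "i < n" "\<not> 0 < ds ! i" for i
    using orth[of "unit_vec n i"] that x by (simp add: vs_def I_def)
  define y where "y = S *\<^sub>v x"
  have y: "y \<in> carrier_vec n" using S x by (simp add: y_def)
  have Ry: "R *\<^sub>v y = x"
    using x R S RS unfolding y_def by (metis assoc_mult_mat_vec one_mult_mat_vec)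
  have y0: "y $ j = 0" if "j < n" "0 < es ! j" for j
    using orth[of "row S j"] that S by (simp add: vs_def J_def y_def)
  have dc: "diagonal_of ds \<in> carrier_mat n n" using len diagonal_of_carrier[of ds] by simp
  have "y \<bullet> (diagonal_of es *\<^sub>v y) = y \<bullet> (transpose_mat R *\<^sub>v (diagonal_of ds *\<^sub>v x))"
    using R dc y by (simp flip: congr add: assoc_mult_mat_vec[of _ n n _ n] Ry)
  also have "\<dots> = (transpose_mat R *\<^sub>v (diagonal_of ds *\<^sub>v x)) \<bullet> y"
    using R dc y x by (intro comm_scalar_prod[of _ n]) auto
  also have "\<dots> = (diagonal_of ds *\<^sub>v x) \<bullet> (R *\<^sub>v y)"
    using R dc y x by (intro transpose_vec_mult_scalar[of _ n n]) auto
  also have "\<dots> = x \<bullet> (diagonal_of ds *\<^sub>v x)"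
    unfolding Ry using dc x by (intro comm_scalar_prod[of _ n]) auto
  finally have eq: "(\<Sum>i<n. es ! i * (y $ i)\<^sup>2) = (\<Sum>i<n. ds ! i * (x $ i)\<^sup>2)"
    using diagonal_of_form[of x ds] diagonal_of_form[of y es] x y len by simp
  have "(\<Sum>i<n. es ! i * (y $ i)\<^sup>2) \<le> 0"
    by (rule sum_nonpos)
       (metis y0 lessThan_iff linorder_not_less mult_nonpos_nonneg mult_zero_right zero_eq_power2
         zero_le_power2)
  moreover have "(\<Sum>i<n. ds ! i * (x $ i)\<^sup>2) > 0"
  proof -
    obtain k where k: "k < n" "x $ k \<noteq> 0" using x by (metis eq_vecI carrier_vecD index_zero_vec)
    then have "0 < ds ! k" using x0 by blast
    then have "0 < ds ! k * (x $ k)\<^sup>2" using k by simp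
    moreover have "0 \<le> ds ! i * (x $ i)\<^sup>2" if "i < n" for i using x0[OF that] by force
    ultimately show ?thesis using k by (intro sum_pos2[of _ k]) auto
  qed
  ultimately show False using eq by simp
qed

lemma filter_neg: "length (filter ((<) 0) (map uminus ds)) = length (filter (\<lambda>d::real. d < 0) ds)"
  by (induction ds) auto

lemma sum_list_sgn:
  "(\<Sum>d\<leftarrow>ds. sgn d) = of_nat (length (filter ((<) 0) ds)) - of_nat (length (filter (\<lambda>d. d < 0) ds))"
  for ds :: "'a::linordered_idom list"
  by (induction ds) (auto simp: sgn_if)

lemma uminus_diagonal_of: "- diagonal_of ds = diagonal_of (map uminus ds)"
  for ds :: "'a::group_add list"
  using diagonal_of_eqI[of "- diagonal_of ds" "map uminus ds"]
  by (auto simp: index_diagonal_of simp flip: map_map)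

lemma inertia:
  fixes ds es :: "real list"
  assumes len: "length ds = n" "length es = n"
    and R: "R \<in> carrier_mat n n" and S: "S \<in> carrier_mat n n" and RS: "R * S = 1\<^sub>m n"
    and congr: "transpose_mat R * diagonal_of ds * R = diagonal_of es"
  shows "length (filter ((<) 0) ds) = length (filter ((<) 0) es)"
proof (rule antisym)
  show "length (filter ((<) 0) ds) \<le> length (filter ((<) 0) es)"
    by (rule inertia_le) fact+
  have SR: "S * R = 1\<^sub>m n" by (rule mat_mult_left_right_inverse[OF R S RS])
  have dc: "diagonal_of ds \<in> carrier_mat n n" using len diagonal_of_carrier[of ds] by simp
  have "transpose_mat S * diagonal_of es * S =
        transpose_mat (R * S) * diagonal_of ds * (R * S)"
    using R S dc by (simp flip: congr add: transpose_mult[of _ n n _ n] assoc_mult_mat[of _ n n _ n _ n])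
  also have "\<dots> = diagonal_of ds"
    by (simp add: RS left_mult_one_mat[OF dc] right_mult_one_mat[OF dc])
  finally show "length (filter ((<) 0) es) \<le> length (filter ((<) 0) ds)"
    by (rule inertia_le[OF len(2,1) S R SR])
qed

text \<open>The matrix is congruent to the diagonal matrix of its eigenvalues, through an orthogonal matrix that
  is also a similarity. By the law of inertia, applied to the form and to its negative, any
  other diagonalization has equally many entries of either sign.\<close>
lemma signature_of_congruent_diagonal:
  fixes A P :: "real mat" and ds :: "real list"
  assumes A: "A \<in> carrier_mat n n" and sym: "transpose_mat A = A"
    and P: "P \<in> carrier_mat n n" and det: "det P \<noteq> 0" and len: "length ds = n"
    and congr: "transpose_mat P * A * P = diagonal_of ds"
  shows "real_of_int (matrix_signature A) = (\<Sum>d\<leftarrow>ds. sgn d)"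
proof -
  obtain Q es where es: "length es = n" and Q: "Q \<in> carrier_mat n n"
    and orth: "transpose_mat Q * Q = 1\<^sub>m n"
    and diag: "transpose_mat Q * A * Q = diagonal_of es"
    using orthogonal_diagonalization[OF A sym] by blast
  have QT: "transpose_mat Q \<in> carrier_mat n n" using Q by simp
  have orth': "Q * transpose_mat Q = 1\<^sub>m n"
    by (rule mat_mult_left_right_inverse[OF QT Q orth])
  have Aeq: "A = Q * diagonal_of es * transpose_mat Q"
  proof -
    have "Q * diagonal_of es * transpose_mat Q = (Q * transpose_mat Q) * A * (Q * transpose_mat Q)"
      using Q A QT by (simp flip: diag add: assoc_mult_mat[of _ n n _ n _ n])
    then show ?thesis using A by (simp add: orth')
  qed
  have "similar_mat A (diagonal_of es)"
    unfolding similar_mat_def similar_mat_wit_def Let_def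
    using A Q QT orth orth' Aeq es diagonal_of_carrier[of es]
    by (intro exI[of _ Q] exI[of _ "transpose_mat Q"]) auto
  then have "char_poly A = (\<Prod>e\<leftarrow>es. [:- e, 1:])"
    by (simp add: char_poly_similar char_poly_diagonal_of)
  note sig = matrix_signature_of_roots[OF A this]
  obtain B where B: "B \<in> carrier_mat n n" and PB: "P * B = 1\<^sub>m n" and BP: "B * P = 1\<^sub>m n"
    using det_non_zero_imp_unit[OF P det, of "()"]
    by (auto simp: Units_def ring_mat_def)
  have PT: "transpose_mat P \<in> carrier_mat n n" and BT: "transpose_mat B \<in> carrier_mat n n"
    using P B by auto
  define R where "R = B * Q"
  define S where "S = transpose_mat Q * P"
  have R: "R \<in> carrier_mat n n" and S: "S \<in> carrier_mat n n"
    using B Q P by (auto simp: R_def S_def)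
  have "R * S = B * (Q * transpose_mat Q) * P"
    using B Q P QT by (simp add: R_def S_def assoc_mult_mat[of _ n n _ n _ n])
  then have RS: "R * S = 1\<^sub>m n" using B by (simp add: orth' BP)
  have "transpose_mat R * (transpose_mat P * A * P) * R = transpose_mat (P * B * Q) * A * (P * B * Q)"
    using A B Q P QT PT BT
    by (simp add: R_def transpose_mult[of _ n n _ n] assoc_mult_mat[of _ n n _ n _ n])
  also have "\<dots> = diagonal_of es" using Q by (simp add: PB diag)
  finally have c: "transpose_mat R * diagonal_of ds * R = diagonal_of es" by (simp add: congr)
  have pos: "length (filter ((<) 0) ds) = length (filter ((<) 0) es)"
    by (rule inertia[OF len es R S RS c])
  have dc: "diagonal_of ds \<in> carrier_mat n n" using len diagonal_of_carrier[of ds] by simp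
  \<comment> \<open>The negated form counts the negative entries.\<close>
  have "transpose_mat R * diagonal_of (map uminus ds) * R = diagonal_of (map uminus es)"
    unfolding uminus_diagonal_of[symmetric] using c carrier_matD[OF R] carrier_matD[OF dc]
    by (simp add: uminus_mult_left_mat uminus_mult_right_mat)
  then have "length (filter ((<) 0) (map uminus ds)) = length (filter ((<) 0) (map uminus es))"
    by (intro inertia[OF _ _ R S RS]) (use len es in auto)
  then show ?thesis
    using pos unfolding sig filter_neg by (simp add: sum_list_sgn)
qed

section \<open>Continuants\<close>

text \<open>The indices are shifted by one: \<open>continuant c (m + 1)\<close> is the numerator \<open>p\<^sub>m\<close>, so that
  the recursion starts from \<open>p\<^bsub>-1\<^esub> = 0\<close> and \<open>p\<^sub>0 = 1\<close>.\<close>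
fun continuant :: "(nat \<Rightarrow> int) \<Rightarrow> nat \<Rightarrow> int" where
  "continuant c 0 = 0"
| "continuant c (Suc 0) = 1"
| "continuant c (Suc (Suc m)) = c (Suc m) * continuant c (Suc m) - continuant c m"

text \<open>The canonical representation, extended by \<open>1/0\<close> to the empty list. This makes the recursion uniform
  and linear in the pair, so that it can also be unfolded at the right end of the list.\<close>
definition cf_rep :: "int list \<Rightarrow> int \<times> int" where
  "cf_rep xs = foldr (\<lambda>x (p, q). (x * p - q, p)) xs (1, 0)"

lemma cf_rep_simps [simp]:
  "cf_rep [] = (1, 0)"
  "fst (cf_rep (x # xs)) = x * fst (cf_rep xs) - snd (cf_rep xs)"
  "snd (cf_rep (x # xs)) = fst (cf_rep xs)"
  by (simp_all add: cf_rep_def split_beta)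

lemma canonical_rep_eq_cf_rep: "xs \<noteq> [] \<Longrightarrow> canonical_rep xs = cf_rep xs"
  by (induction xs rule: canonical_rep.induct) (auto simp: cf_rep_def)

text \<open>Both sides are transformed by the same linear map when an entry is added on the left. This is what
  turns the definition of \<open>p\<^sub>m\<close>, which peels off \<open>c\<^sub>1\<close>, into the recursion in \<open>m\<close>.\<close>
lemma cf_rep_append_two:
  "fst (cf_rep (xs @ [y, z])) = z * fst (cf_rep (xs @ [y])) - fst (cf_rep xs) \<and>
   snd (cf_rep (xs @ [y, z])) = z * snd (cf_rep (xs @ [y])) - snd (cf_rep xs)"
proof (induction xs)
  case (Cons x xs)
  show ?case
    unfolding append_Cons cf_rep_simps Cons.IH[THEN conjunct1] Cons.IH[THEN conjunct2]
    by (simp add: algebra_simps)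
qed simp

lemma fst_cf_rep_prefix: "fst (cf_rep (map c [1..<Suc m])) = continuant c (Suc m)"
proof (induction m rule: induct_nat_012)
  case (ge2 m)
  have "[1..<Suc (Suc (Suc m))] = [1..<Suc m] @ [Suc m, Suc (Suc m)]"
    by simp
  moreover have "[1..<Suc (Suc m)] = [1..<Suc m] @ [Suc m]" by simp
  ultimately show ?case
    using ge2 cf_rep_append_two[of "map c [1..<Suc m]" "c (Suc m)" "c (Suc (Suc m))"]
    by (simp del: upt_Suc)
qed (auto simp: cf_rep_def)

lemma cf_numerator_eq_continuant:
  assumes "m \<ge> 1"
  shows "cf_numerator c m = continuant c (Suc m)"
  using assms fst_cf_rep_prefix[of c m]
  by (simp add: cf_numerator_def canonical_rep_eq_cf_rep del: upt_Suc)

section \<open>The Goeritz form as the energy of a network\<close>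

lemma goeritz_entry_commute: "goeritz_entry D a b = goeritz_entry D b a"
  by (simp add: goeritz_entry_def goeritz_offdiag_def crossings_joining_def insert_commute)

text \<open>As the rows of \<open>g\<close> sum to zero, \<open>g \<psi>\<close> at \<open>a\<close> is the sum of \<open>g\<^sub>a\<^sub>d (\<psi> d - \<psi> a)\<close> over all \<open>d\<close>. A crossing
  with distinct ends \<open>l\<close> and \<open>r\<close> enters twice, with \<open>a = l\<close> and with \<open>a = r\<close>; a loop does not
  enter at all, and its difference is zero.\<close>
lemma goeritz_form_eq_sum_crossings:
  fixes D :: "('r, 'x) diagram" and \<phi> \<psi> :: "'r \<Rightarrow> 'a::comm_ring_1"
  defines "W \<equiv> white_regions D" and "l \<equiv> \<lambda>x. corner D x False" and "r \<equiv> \<lambda>x. corner D x True"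
  assumes finW: "finite W" and finX: "finite (crossings D)"
    and corner: "\<And>x s. x \<in> crossings D \<Longrightarrow> corner D x s \<in> W"
    and zero: "\<phi> (unbounded D) = 0" "\<psi> (unbounded D) = 0"
  shows "(\<Sum>a\<in>W - {unbounded D}. \<Sum>b\<in>W - {unbounded D}. \<phi> a * of_int (goeritz_entry D a b) * \<psi> b) =
         (\<Sum>x\<in>crossings D. of_int (eta D x) * (\<phi> (l x) - \<phi> (r x)) * (\<psi> (l x) - \<psi> (r x)))"
proof -
  let ?X = "crossings D"
  have off: "of_int (goeritz_offdiag D a d) = (\<Sum>x\<in>?X. if {l x, r x} = {a, d} then - of_int (eta D x) else (0::'a))"
    for a d
    using finX by (simp add: goeritz_offdiag_def crossings_joining_def sum.inter_filter l_def r_def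
        flip: sum_negf) (auto intro!: sum.cong)
  have row: "(\<Sum>b\<in>W. of_int (goeritz_entry D a b) * \<psi> b) =
             (\<Sum>d\<in>W. of_int (goeritz_offdiag D a d) * (\<psi> d - \<psi> a))" if "a \<in> W" for a
  proof -
    have "(\<Sum>b\<in>W. of_int (goeritz_entry D a b) * \<psi> b) =
          of_int (goeritz_entry D a a) * \<psi> a + (\<Sum>b\<in>W - {a}. of_int (goeritz_entry D a b) * \<psi> b)"
      using finW that by (rule sum.remove)
    also have "(\<Sum>b\<in>W - {a}. of_int (goeritz_entry D a b) * \<psi> b) =
               (\<Sum>b\<in>W - {a}. of_int (goeritz_offdiag D a b) * \<psi> b)"
      by (rule sum.cong) (auto simp: goeritz_entry_def)
    also have "of_int (goeritz_entry D a a) * \<psi> a = (\<Sum>b\<in>W - {a}. of_int (goeritz_offdiag D a b) * (- \<psi> a))"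
      by (simp add: goeritz_entry_def W_def sum_distrib_right sum_negf)
    also have "\<dots> + (\<Sum>b\<in>W - {a}. of_int (goeritz_offdiag D a b) * \<psi> b) =
               (\<Sum>d\<in>W - {a}. of_int (goeritz_offdiag D a d) * (\<psi> d - \<psi> a))"
      by (simp add: algebra_simps flip: sum.distrib)
    also have "\<dots> = (\<Sum>d\<in>W. of_int (goeritz_offdiag D a d) * (\<psi> d - \<psi> a))"
      using finW that by (simp add: sum.remove)
    finally show ?thesis .
  qed
  have single: "(\<Sum>a\<in>W. \<Sum>d\<in>W. if {l x, r x} = {a, d} then \<phi> a * (\<psi> d - \<psi> a) else 0) =
                - ((\<phi> (l x) - \<phi> (r x)) * (\<psi> (l x) - \<psi> (r x)))" if x: "x \<in> ?X" for x
  proof -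
    have lr: "l x \<in> W" "r x \<in> W" using corner[OF x] by (simp_all add: l_def r_def)
    show ?thesis
    proof (cases "l x = r x")
      case True
      then have "(\<Sum>a\<in>W. \<Sum>d\<in>W. if {l x, r x} = {a, d} then \<phi> a * (\<psi> d - \<psi> a) else 0) = 0"
        by (intro sum.neutral ballI) (auto simp: doubleton_eq_iff)
      then show ?thesis using True by simp
    next
      case False
      have "(\<Sum>a\<in>W. \<Sum>d\<in>W. if {l x, r x} = {a, d} then \<phi> a * (\<psi> d - \<psi> a) else 0) =
            (\<Sum>a\<in>W. \<Sum>d\<in>W. (if a = l x then if d = r x then \<phi> a * (\<psi> d - \<psi> a) else 0 else 0) +
                             (if a = r x then if d = l x then \<phi> a * (\<psi> d - \<psi> a) else 0 else 0))"
        using False by (intro sum.cong refl) (auto simp: doubleton_eq_iff)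
      also have "\<dots> = (\<Sum>a\<in>W. (if a = l x then \<phi> a * (\<psi> (r x) - \<psi> a) else 0) +
                             (if a = r x then \<phi> a * (\<psi> (l x) - \<psi> a) else 0))"
        using finW lr by (intro sum.cong refl) (auto simp: sum.distrib)
      also have "\<dots> = \<phi> (l x) * (\<psi> (r x) - \<psi> (l x)) + \<phi> (r x) * (\<psi> (l x) - \<psi> (r x))"
        using finW lr by (simp add: sum.distrib)
      finally show ?thesis by (simp add: algebra_simps)
    qed
  qed
  have "(\<Sum>a\<in>W - {unbounded D}. \<Sum>b\<in>W - {unbounded D}. \<phi> a * of_int (goeritz_entry D a b) * \<psi> b) =
        (\<Sum>a\<in>W. \<Sum>b\<in>W. \<phi> a * of_int (goeritz_entry D a b) * \<psi> b)"
    using finW zero by (intro sum.mono_neutral_cong_left) (auto intro!: sum.mono_neutral_left)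
  also have "\<dots> = (\<Sum>a\<in>W. \<phi> a * (\<Sum>b\<in>W. of_int (goeritz_entry D a b) * \<psi> b))"
    by (simp add: sum_distrib_left mult.assoc)
  also have "\<dots> = (\<Sum>a\<in>W. \<Sum>d\<in>W. \<Sum>x\<in>?X. - of_int (eta D x) * (if {l x, r x} = {a, d} then \<phi> a * (\<psi> d - \<psi> a) else 0))"
    by (intro sum.cong refl) (simp add: row off sum_distrib_left sum_distrib_right, intro sum.cong refl, simp)
  also have "\<dots> = (\<Sum>a\<in>W. \<Sum>x\<in>?X. \<Sum>d\<in>W. - of_int (eta D x) * (if {l x, r x} = {a, d} then \<phi> a * (\<psi> d - \<psi> a) else 0))"
    by (intro sum.cong refl sum.swap)
  also have "\<dots> = (\<Sum>x\<in>?X. \<Sum>a\<in>W. \<Sum>d\<in>W. - of_int (eta D x) * (if {l x, r x} = {a, d} then \<phi> a * (\<psi> d - \<psi> a) else 0))"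
    by (rule sum.swap)
  also have "\<dots> = (\<Sum>x\<in>?X. of_int (eta D x) * (\<phi> (l x) - \<phi> (r x)) * (\<psi> (l x) - \<psi> (r x)))"
    by (intro sum.cong refl) (simp only: flip: sum_distrib_left, simp add: single mult.assoc)
  finally show ?thesis .
qed

definition potential_drop :: "(nat \<Rightarrow> int) \<Rightarrow> nat \<Rightarrow> (region \<Rightarrow> 'a::field_char_0) \<Rightarrow> nat \<Rightarrow> nat \<Rightarrow> 'a" where
  "potential_drop c n \<phi> i j = \<phi> (twist_path c n i j) - \<phi> (twist_path c n i (j - 1))"

text \<open>The energy of the \<open>i\<close>-th twist region, for functions that vanish on \<open>e\<^sup>0\<close>.\<close>
definition twist_term :: "(nat \<Rightarrow> int) \<Rightarrow> nat \<Rightarrow> (region \<Rightarrow> 'a::field_char_0) \<Rightarrow> (region \<Rightarrow> 'a) \<Rightarrow> nat \<Rightarrow> 'a" where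
  "twist_term c n \<phi> \<psi> i =
     (if odd i then - of_int (sgn (c i)) *
        (\<Sum>j=1..nat \<bar>c i\<bar>. potential_drop c n \<phi> i j *
                           potential_drop c n \<psi> i j)
      else of_int (c i) * \<phi> (E i) * \<psi> (E i))"

lemma twist_term_commute: "twist_term c n \<phi> \<psi> i = twist_term c n \<psi> \<phi> i"
  by (simp add: twist_term_def mult_ac)

locale two_bridge =
  fixes c :: "nat \<Rightarrow> int" and n :: nat
  assumes odd_n: "odd n" and nz: "\<And>i. 1 \<le> i \<Longrightarrow> i \<le> n \<Longrightarrow> c i \<noteq> 0"
begin

abbreviation D where "D \<equiv> two_bridge_diagram c n"

lemma white_regions_D: "white_regions D = {E i | i. even i \<and> i < n} \<union>
    {B i j | i j. odd i \<and> i \<le> n \<and> 1 \<le> j \<and> j < nat \<bar>c i\<bar>}"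
  by (simp add: two_bridge_diagram_def)

lemma crossings_D: "crossings D = (SIGMA i:{1..n}. {1..nat \<bar>c i\<bar>})"
  by (auto simp: two_bridge_diagram_def)

lemma finite_white_regions_D: "finite (white_regions D)"
proof -
  have "{B i j | i j. odd i \<and> i \<le> n \<and> 1 \<le> j \<and> j < nat \<bar>c i\<bar>} \<subseteq>
        (\<lambda>(i, j). B i j) ` (SIGMA i:{..n}. {..<nat \<bar>c i\<bar>})" by force
  then have "finite {B i j | i j. odd i \<and> i \<le> n \<and> 1 \<le> j \<and> j < nat \<bar>c i\<bar>}"
    by (rule finite_subset) auto
  then show ?thesis by (simp add: white_regions_D)
qed

lemma twist_path_in_white_regions:
  assumes "odd i" "i \<le> n"
  shows "twist_path c n i j \<in> white_regions D"
proof -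
  have "i < n \<Longrightarrow> Suc i < n" using assms odd_n by (metis Suc_lessI even_Suc)
  then show ?thesis
    using assms odd_n by (auto simp: twist_path_def white_regions_D odd_pos)
qed

lemma corner_D_eq:
  "corner D (i, j) s = (if odd i then twist_path c n i (if s then j else j - 1)
     else if s then E 0 else E i)"
  by (simp add: two_bridge_diagram_def)

lemma corner_D: "x \<in> crossings D \<Longrightarrow> corner D x s \<in> white_regions D"
proof -
  assume "x \<in> crossings D"
  then obtain i j where x: "x = (i, j)" "1 \<le> i" "i \<le> n" by (auto simp: crossings_D)
  have "even i \<Longrightarrow> i < n" using x odd_n by (cases "i = n") auto
  then have "even i \<Longrightarrow> E i \<in> white_regions D \<and> E 0 \<in> white_regions D"
    using x by (auto simp: white_regions_D)
  then show ?thesis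
    using x twist_path_in_white_regions by (auto simp: corner_D_eq)
qed

lemma unbounded_D [simp]: "unbounded D = E 0"
  by (simp add: two_bridge_diagram_def)

lemma goeritz_form_D:
  fixes \<phi> \<psi> :: "region \<Rightarrow> 'a::field_char_0"
  assumes "\<phi> (E 0) = 0" "\<psi> (E 0) = 0"
  shows "(\<Sum>a\<in>white_regions D - {E 0}. \<Sum>b\<in>white_regions D - {E 0}.
            \<phi> a * of_int (goeritz_entry D a b) * \<psi> b) = (\<Sum>i=1..n. twist_term c n \<phi> \<psi> i)"
proof -
  have fin: "finite (crossings D)" by (simp add: crossings_D)
  define F where "F x = of_int (eta D x) * (\<phi> (corner D x False) - \<phi> (corner D x True)) *
                        (\<psi> (corner D x False) - \<psi> (corner D x True))" for x
  have "(\<Sum>a\<in>white_regions D - {E 0}. \<Sum>b\<in>white_regions D - {E 0}.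
            \<phi> a * of_int (goeritz_entry D a b) * \<psi> b) = (\<Sum>x\<in>crossings D. F x)"
    using goeritz_form_eq_sum_crossings[OF finite_white_regions_D fin corner_D, of \<phi> \<psi>] assms
    by (simp add: F_def)
  also have "\<dots> = (\<Sum>i=1..n. \<Sum>j=1..nat \<bar>c i\<bar>. F (i, j))"
    by (simp add: crossings_D sum.Sigma)
  also have "\<dots> = (\<Sum>i=1..n. twist_term c n \<phi> \<psi> i)"
  proof (rule sum.cong[OF refl])
    fix i assume i: "i \<in> {1..n}"
    then have c: "c i \<noteq> 0" using nz by simp
    show "(\<Sum>j=1..nat \<bar>c i\<bar>. F (i, j)) = twist_term c n \<phi> \<psi> i"
    proof (cases "odd i")
      case True
      then show ?thesis
        by (simp add: twist_term_def sum_distrib_left F_def eta_two_bridge c)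
           (auto simp: corner_D_eq potential_drop_def algebra_simps intro!: sum.cong)
    next
      case False
      have s: "(of_int (sgn (c i)) :: 'a) * of_int \<bar>c i\<bar> = of_int (c i)"
        by (metis of_int_mult sgn_mult_abs)
      have "(\<Sum>j=1..nat \<bar>c i\<bar>. F (i, j)) = of_nat (nat \<bar>c i\<bar>) * (of_int (sgn (c i)) * \<phi> (E i) * \<psi> (E i))"
        using False by (simp add: F_def eta_two_bridge c assms corner_D_eq)
      also have "\<dots> = (of_int (sgn (c i)) * of_int \<bar>c i\<bar>) * \<phi> (E i) * \<psi> (E i)"
        by (simp add: mult_ac)
      finally show ?thesis using False by (simp add: twist_term_def s)
    qed
  qed
  finally show ?thesis .
qed

end

section \<open>An orthogonal basis for the energy\<close>

text \<open>For even \<open>l\<close> this is the potential at \<open>e\<^sup>l\<close>, for odd \<open>l\<close> the current in the \<open>l\<close>-th path, counted as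
  potential difference divided by \<open>c\<^sub>l\<close>; the signs, which have period four in \<open>l\<close>, are those that Ohm's
  and Kirchhoff's laws need. At \<open>l = 0\<close> the value is zero, as \<open>e\<^sup>0\<close> is earthed.\<close>
definition potential :: "(nat \<Rightarrow> int) \<Rightarrow> nat \<Rightarrow> 'a::field_char_0" where
  "potential c l = (-1) ^ ((l + 1) div 2) * of_int (continuant c l)"

lemma potential_0 [simp]: "potential c 0 = 0"
  by (simp add: potential_def)

lemma potential_ohm:
  assumes "odd l"
  shows "potential c (Suc l) - potential c (l - 1) = of_int (c l) * potential c l"
proof -
  obtain m where "l = Suc (2 * m)" using assms by (metis oddE Suc_eq_plus1)
  then show ?thesis by (simp add: potential_def algebra_simps)
qed

text \<open>The current that arrives at \<open>e\<^sup>l\<close> along the cycle and does not leave it again along the cycle flows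
  to \<open>e\<^sup>0\<close> through the crossings of the \<open>l\<close>-th twist region.\<close>
lemma potential_kirchhoff:
  assumes "even l" "l > 0"
  shows "potential c (l - 1) - potential c (Suc l) = of_int (c l) * potential c l"
proof -
  obtain m where "l = Suc (Suc (2 * m))"
    using assms by (metis evenE gr0_conv_Suc mult_Suc_right nat_0_less_mult_iff add_2_eq_Suc)
  then show ?thesis by (simp add: potential_def algebra_simps)
qed

text \<open>The ramp that rises linearly from \<open>0\<close> to \<open>1\<close> on the first \<open>k\<close> steps of the \<open>i\<close>-th path and
  then drops back to \<open>0\<close>.\<close>
definition string_mode :: "nat \<Rightarrow> nat \<Rightarrow> region \<Rightarrow> 'a::field_char_0" where
  "string_mode i k a = (case a of E l \<Rightarrow> 0 | B l j \<Rightarrow> if l = i \<and> j \<le> k then of_nat j / of_nat k else 0)"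

text \<open>Node values \<open>v\<close>, extended so as to be affine along each path. The last path ends in \<open>e\<^sup>0\<close>, so this
  is meant for \<open>v (n + 1) = 0\<close>.\<close>
definition interpolation :: "(nat \<Rightarrow> int) \<Rightarrow> (nat \<Rightarrow> 'a::field_char_0) \<Rightarrow> region \<Rightarrow> 'a" where
  "interpolation c v a = (case a of E l \<Rightarrow> v l
     | B l j \<Rightarrow> v (l - 1) + of_nat j / of_int \<bar>c l\<bar> * (v (Suc l) - v (l - 1)))"

definition truncated_potential :: "(nat \<Rightarrow> int) \<Rightarrow> nat \<Rightarrow> nat \<Rightarrow> 'a::field_char_0" where
  "truncated_potential c t l = (if l \<le> t then potential c l / potential c t else 0)"

text \<open>The vector that Gram-Schmidt attaches to a white region.\<close>
fun mode :: "(nat \<Rightarrow> int) \<Rightarrow> region \<Rightarrow> region \<Rightarrow> 'a::field_char_0" where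
  "mode c (B i k) = string_mode i k"
| "mode c (E t) = interpolation c (truncated_potential c t)"

fun mode_norm :: "(nat \<Rightarrow> int) \<Rightarrow> region \<Rightarrow> 'a::field_char_0" where
  "mode_norm c (B i k) = - of_int (sgn (c i)) * (of_nat (k + 1) / of_nat k)"
| "mode_norm c (E t) = of_int (continuant c (t + 2)) / of_int (c (t + 1) * continuant c t)"

context two_bridge
begin

lemma string_mode_path:
  assumes "k < nat \<bar>c i\<bar>" "j \<le> nat \<bar>c l\<bar>"
  shows "string_mode i k (twist_path c n l j) = (if l = i \<and> j \<le> k then of_nat j / of_nat k else 0)"
  using assms by (auto simp: string_mode_def twist_path_def)

lemma string_mode_diff:
  assumes "k < nat \<bar>c i\<bar>" "1 \<le> j" "j \<le> nat \<bar>c l\<bar>" "1 \<le> k"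
  shows "potential_drop c n (string_mode i k) l j =
         (if l \<noteq> i then 0 else if j \<le> k then 1 / of_nat k else if j = Suc k then -1 else 0)"
  using assms by (auto simp: potential_drop_def string_mode_path[OF assms(1)] of_nat_diff diff_divide_distrib)

lemma interpolation_path:
  assumes "v 0 = 0" "v (Suc n) = 0" "odd l" "1 \<le> l" "l \<le> n" "j \<le> nat \<bar>c l\<bar>"
  shows "interpolation c v (twist_path c n l j) =
         v (l - 1) + of_nat j / of_int \<bar>c l\<bar> * (v (Suc l) - v (l - 1))"
proof -
  have c: "c l \<noteq> 0" using nz assms by simp
  then have "of_nat (nat \<bar>c l\<bar>) / of_int \<bar>c l\<bar> = (1::'a)"
    by simp
  then show ?thesis using assms c by (auto simp: interpolation_def twist_path_def)
qed

lemma interpolation_diff: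
  assumes "v 0 = 0" "v (Suc n) = 0" "odd l" "1 \<le> l" "l \<le> n" "1 \<le> j" "j \<le> nat \<bar>c l\<bar>"
  shows "potential_drop c n (interpolation c v) l j =
         (v (Suc l) - v (l - 1)) / of_int \<bar>c l\<bar>"
proof -
  have "j - 1 \<le> nat \<bar>c l\<bar>" using assms by simp
  then show ?thesis using assms
    by (simp add: potential_drop_def interpolation_path[OF assms(1-5)] of_nat_diff diff_divide_distrib left_diff_distrib)
qed

text \<open>The ramp has \<open>k\<close> differences \<open>1/k\<close>, followed by one difference \<open>-1\<close>. So pairing with it compares
  a mean of \<open>k\<close> values with the next value and gives zero if all these values agree.\<close>
lemma string_mode_pairing:
  fixes h :: "nat \<Rightarrow> 'a::field_char_0"
  assumes "k < nat \<bar>c i\<bar>" "1 \<le> k"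
  shows "(\<Sum>j=1..nat \<bar>c i\<bar>. potential_drop c n (string_mode i k) i j * h j)
         = (\<Sum>j=1..k. h j) / of_nat k - h (Suc k)"
proof -
  have "(\<Sum>j=1..nat \<bar>c i\<bar>. potential_drop c n (string_mode i k) i j * h j)
        = (\<Sum>j=1..nat \<bar>c i\<bar>. (if j \<le> k then h j / of_nat k else 0) + (if j = Suc k then - h (Suc k) else 0))"
    using assms by (intro sum.cong refl) (auto simp: string_mode_diff)
  also have "\<dots> = (\<Sum>j=1..nat \<bar>c i\<bar>. if j \<le> k then h j / of_nat k else 0) - h (Suc k)"
    using assms by (simp add: sum.distrib)
  also have "(\<Sum>j=1..nat \<bar>c i\<bar>. if j \<le> k then h j / of_nat k else 0) = (\<Sum>j=1..k. h j / of_nat k)"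
    using assms by (intro sum.mono_neutral_cong_right) auto
  finally show ?thesis by (simp add: sum_divide_distrib)
qed

text \<open>The longer ramp has constant differences on all the steps where the shorter one is not constant.\<close>
lemma twist_term_strings:
  assumes "odd l" "k < nat \<bar>c i\<bar>" "1 \<le> k" "k' < nat \<bar>c i'\<bar>" "1 \<le> k'" "k \<le> k'"
  shows "twist_term c n (string_mode i k) (string_mode i' k') l =
         (if l = i \<and> i = i' \<and> k = k' then mode_norm c (B i k) else (0::'a::field_char_0))"
proof (cases "l = i \<and> l = i'")
  case True
  then have l: "l = i" and i': "i' = i" by auto
  note assms = assms[unfolded l i']
  have "(\<Sum>j=1..k. potential_drop c n (string_mode i k') i j) = (\<Sum>j=1..k. 1 / of_nat k' :: 'a)"
    using assms by (intro sum.cong refl) (auto simp: string_mode_diff)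
  moreover have "potential_drop c n (string_mode i k') i (Suc k) = (if k = k' then -1 else 1 / of_nat k' :: 'a)"
    using assms by (subst string_mode_diff) auto
  ultimately show ?thesis
    unfolding l i' using assms
    by (simp add: twist_term_def string_mode_pairing[unfolded One_nat_def]) (auto simp: field_simps)
next
  case False
  have "(\<Sum>j=1..nat \<bar>c l\<bar>. potential_drop c n (string_mode i k) l j *
        potential_drop c n (string_mode i' k') l j) = (0::'a)"
    using False assms by (intro sum.neutral ballI) (auto simp: string_mode_diff)
  then show ?thesis using False assms by (auto simp: twist_term_def)
qed

lemma twist_term_string_interpolation:
  fixes v :: "nat \<Rightarrow> 'a::field_char_0"
  assumes v: "v 0 = 0" "v (Suc n) = 0" and l: "1 \<le> l" "l \<le> n" and k: "k < nat \<bar>c i\<bar>" "1 \<le> k"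
  shows "twist_term c n (string_mode i k) (interpolation c v) l = 0"
proof (cases "odd l")
  case odd: True
  show ?thesis
  proof (cases "l = i")
    case True
    have "(\<Sum>j=1..k. potential_drop c n (interpolation c v) i j) =
          (\<Sum>j=1..k. (v (Suc i) - v (i - 1)) / of_int \<bar>c i\<bar>)"
      using True odd l v k by (intro sum.cong refl interpolation_diff) auto
    moreover have "potential_drop c n (interpolation c v) i (Suc k) =
          (v (Suc i) - v (i - 1)) / of_int \<bar>c i\<bar>"
      using True odd l v k by (intro interpolation_diff) auto
    ultimately show ?thesis
      using True odd k by (simp add: twist_term_def string_mode_pairing[unfolded One_nat_def])
  next
    case False
    then have "(\<Sum>j=1..nat \<bar>c l\<bar>. potential_drop c n (string_mode i k) l j *
        potential_drop c n (interpolation c v) l j) = 0"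
      using k by (intro sum.neutral ballI) (auto simp: string_mode_diff)
    then show ?thesis by (simp add: twist_term_def odd)
  qed
qed (simp add: twist_term_def string_mode_def)

lemma twist_term_interpolations:
  fixes v w :: "nat \<Rightarrow> 'a::field_char_0"
  assumes "v 0 = 0" "v (Suc n) = 0" "w 0 = 0" "w (Suc n) = 0" "1 \<le> l" "l \<le> n"
  shows "twist_term c n (interpolation c v) (interpolation c w) l =
     (if odd l then - ((v (Suc l) - v (l - 1)) * (w (Suc l) - w (l - 1)) / of_int (c l))
      else of_int (c l) * v l * w l)"
proof (cases "odd l")
  case True
  have c: "c l \<noteq> 0" using nz assms by simp
  have "(\<Sum>j=1..nat \<bar>c l\<bar>. potential_drop c n (interpolation c v) l j *
                     potential_drop c n (interpolation c w) l j) =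
        (\<Sum>j=1..nat \<bar>c l\<bar>. (v (Suc l) - v (l - 1)) / of_int \<bar>c l\<bar> * ((w (Suc l) - w (l - 1)) / of_int \<bar>c l\<bar>))"
    using True assms by (intro sum.cong refl) (simp add: interpolation_diff)
  also have "\<dots> = (v (Suc l) - v (l - 1)) * (w (Suc l) - w (l - 1)) / of_int \<bar>c l\<bar>"
    using c by simp
  finally show ?thesis using True c by (simp add: twist_term_def sgn_if)
qed (simp add: twist_term_def interpolation_def)

lemma truncated_potential_current:
  assumes "odd l" "Suc l \<le> t" "Suc l \<le> n"
  shows "(truncated_potential c t (Suc l) - truncated_potential c t (l - 1)) / of_int (c l) =
         potential c l / potential c t"
proof -
  have "c l \<noteq> 0" using nz[of l] assms by (cases l) auto
  moreover have "l - 1 \<le> t" using assms by simp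
  ultimately show ?thesis
    using assms potential_ohm[OF assms(1), of c, where 'a = 'a]
    by (simp add: truncated_potential_def flip: diff_divide_distrib)
qed

text \<open>Summation by parts. Write \<open>y\<close> for the potentials, \<open>v\<close> for the first function and normalize the second
  one to be \<open>y\<close>. For even \<open>l\<close>, by Ohm's law the path \<open>l + 1\<close> contributes \<open>- (v\<^bsub>l+2\<^esub> - v\<^sub>l) y\<^bsub>l+1\<^esub>\<close> and by Kirchhoff's
  law the node \<open>l + 2\<close> contributes \<open>v\<^bsub>l+2\<^esub> (y\<^bsub>l+1\<^esub> - y\<^bsub>l+3\<^esub>)\<close>, which telescopes.\<close>
lemma twist_terms_below_truncation:
  assumes "even e" "e < t" "t < n" "even t" "s < n"
  shows "(\<Sum>l=1..e. twist_term c n (mode c (E s)) (mode c (E t)) l) =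
         - (truncated_potential c s e * potential c (Suc e) / (potential c t :: 'a::field_char_0))"
proof -
  obtain m where "e = 2 * m" using \<open>even e\<close> by blast
  have "2 * m < t \<Longrightarrow> (\<Sum>l=1..2 * m. twist_term c n (mode c (E s)) (mode c (E t)) l) =
         - (truncated_potential c s (2 * m) * potential c (Suc (2 * m)) / (potential c t :: 'a))"
  proof (induction m)
    case 0
    then show ?case by (simp add: truncated_potential_def)
  next
    case (Suc m)
    let ?e = "2 * m"
    let ?v = "truncated_potential c s :: nat \<Rightarrow> 'a" and ?w = "truncated_potential c t :: nat \<Rightarrow> 'a"
    let ?y = "potential c :: nat \<Rightarrow> 'a"
    have bd: "?v 0 = 0" "?v (Suc n) = 0" "?w 0 = 0" "?w (Suc n) = 0"
      using assms by (auto simp: truncated_potential_def)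
    have lt: "Suc (Suc ?e) < t" using Suc.prems by simp
    have 1: "twist_term c n (mode c (E s)) (mode c (E t)) (Suc ?e) =
             - ((?v (Suc (Suc ?e)) - ?v ?e) * (?y (Suc ?e) / ?y t))"
      using truncated_potential_current[of "Suc ?e" t, where 'a = 'a] lt assms bd
      by (simp add: twist_term_interpolations flip: times_divide_eq_right)
    have 2: "twist_term c n (mode c (E s)) (mode c (E t)) (Suc (Suc ?e)) =
             ?v (Suc (Suc ?e)) * ((?y (Suc ?e) - ?y (Suc (Suc (Suc ?e)))) / ?y t)"
      using potential_kirchhoff[of "Suc (Suc ?e)" c, where 'a = 'a] lt assms bd
      by (simp add: twist_term_interpolations truncated_potential_def[of c t])
    have "(\<Sum>l=1..2 * Suc m. twist_term c n (mode c (E s)) (mode c (E t)) l) =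
          (\<Sum>l=1..?e. twist_term c n (mode c (E s)) (mode c (E t)) l) +
          twist_term c n (mode c (E s)) (mode c (E t)) (Suc ?e) +
          twist_term c n (mode c (E s)) (mode c (E t)) (Suc (Suc ?e))"
      by simp
    also have "\<dots> = - (?v (Suc (Suc ?e)) * ?y (Suc (Suc (Suc ?e))) / ?y t)"
      using Suc.IH lt unfolding 1 2 by (simp add: algebra_simps diff_divide_distrib)
    finally show ?case by simp
  qed
  then show ?thesis using \<open>e = 2 * m\<close> assms by simp
qed

text \<open>Only the path before \<open>e\<^sup>t\<close>, the node \<open>e\<^sup>t\<close> itself and the path after it remain. Together with the
  telescoped sum they give the value of the first function at \<open>e\<^sup>t\<close>, which is \<open>0\<close> for \<open>s < t\<close>, times the
  net current \<open>c\<^sub>t - y\<^bsub>t-1\<^esub>/y\<^sub>t - 1/c\<^bsub>t+1\<^esub>\<close>. The latter is \<open>- y\<^bsub>t+2\<^esub> / (c\<^bsub>t+1\<^esub> y\<^sub>t)\<close> by one more step of the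
  recursion.\<close>
lemma form_of_potential_modes:
  assumes s: "even s" "1 \<le> s" "s \<le> t" and t: "even t" "t < n" and y: "continuant c t \<noteq> 0"
  shows "(\<Sum>l=1..n. twist_term c n (mode c (E s)) (mode c (E t)) l) =
         (if s = t then mode_norm c (E t) else (0::'a::field_char_0))"
proof -
  let ?T = "twist_term c n (mode c (E s)) (mode c (E t) :: region \<Rightarrow> 'a)"
  let ?v = "truncated_potential c s :: nat \<Rightarrow> 'a" and ?w = "truncated_potential c t :: nat \<Rightarrow> 'a"
  let ?y = "potential c :: nat \<Rightarrow> 'a"
  have bd: "?v 0 = 0" "?v (Suc n) = 0" "?w 0 = 0" "?w (Suc n) = 0"
    using assms by (auto simp: truncated_potential_def)
  obtain e where e: "t = Suc (Suc e)" "even e"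
    using s t by (metis One_nat_def Suc_le_D Suc_le_mono even_Suc le_trans odd_Suc_minus_one
        not0_implies_Suc odd_one)
  have yt: "?y t \<noteq> 0" using y by (simp add: potential_def)
  have vanish: "?v (Suc (Suc t)) = 0" using s by (simp add: truncated_potential_def)
  have c: "(of_int (c (Suc t)) :: 'a) \<noteq> 0" using nz[of "Suc t"] t by simp
  have "sum ?T {1..n} = sum ?T {1..Suc t}"
    using t s bd by (intro sum.mono_neutral_right)
      (auto simp: twist_term_interpolations truncated_potential_def[of c t])
  also have "\<dots> = sum ?T {1..e} + ?T (Suc e) + ?T t + ?T (Suc t)"
    by (simp add: e)
  also have "sum ?T {1..e} = - (?v e * ?y (Suc e) / ?y t)"
    by (rule twist_terms_below_truncation) (use s t e in auto)
  also have "?T (Suc e) = - ((?v t - ?v e) * (?y (Suc e) / ?y t))"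
    using truncated_potential_current[of "Suc e" t, where 'a = 'a] t e bd
    by (simp add: twist_term_interpolations flip: times_divide_eq_right)
  also have "?T t = of_int (c t) * ?v t"
    using t s bd yt by (simp add: twist_term_interpolations truncated_potential_def[of c t])
  also have "?T (Suc t) = - (?v t / of_int (c (Suc t)))"
    using t s bd yt vanish
    by (simp add: twist_term_interpolations truncated_potential_def[of c t])
  finally have sum: "sum ?T {1..n} = ?v t * (of_int (c t) - ?y (Suc e) / ?y t - 1 / of_int (c (Suc t)))"
    by (simp add: algebra_simps diff_divide_distrib)
  show ?thesis
  proof (cases "s = t")
    case True
    have "of_int (c t) - ?y (Suc e) / ?y t - 1 / of_int (c (Suc t)) =
          - (?y (Suc (Suc t)) / (of_int (c (Suc t)) * ?y t))"
      using potential_kirchhoff[of t c, where 'a = 'a] potential_ohm[of "Suc t" c, where 'a = 'a] t e yt c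
      by (simp add: field_simps)
    also have "\<dots> = mode_norm c (E t)"
      using t by (simp add: potential_def)
    finally show ?thesis using True yt sum by (simp add: truncated_potential_def)
  next
    case False
    then show ?thesis using s sum by (simp add: truncated_potential_def)
  qed
qed

end

section \<open>Diagonalization and signature of the Goeritz matrix\<close>

text \<open>Elements of different blocks are related both ways, so the order of the blocks does not matter.\<close>
lemma sorted_wrt_concat_blocks:
  assumes "distinct is" "\<And>i. i \<in> set is \<Longrightarrow> sorted_wrt R (f i)"
    and "\<And>i j x y. i \<in> set is \<Longrightarrow> j \<in> set is \<Longrightarrow> i \<noteq> j \<Longrightarrow> x \<in> set (f i) \<Longrightarrow> y \<in> set (f j) \<Longrightarrow> R x y"
  shows "sorted_wrt R (concat (map f is))"
  using assms
proof (induction "is")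
  case (Cons i "is")
  have "sorted_wrt R (concat (map f is))"
  proof (rule Cons.IH)
    fix i' j x y
    assume "i' \<in> set is" "j \<in> set is" "i' \<noteq> j" "x \<in> set (f i')" "y \<in> set (f j)"
    then show "R x y" by (intro Cons.prems(3)[of i' j]) auto
  qed (use Cons.prems(1,2) in auto)
  moreover have "R x y" if "x \<in> set (f i)" "y \<in> set (concat (map f is))" for x y
    using that Cons.prems(1) by (auto intro: Cons.prems(3))
  ultimately show ?case
    using Cons.prems(2)[of i] by (simp add: sorted_wrt_append)
qed simp

lemma sum_list_concat_map: "sum_list (concat (map f xs)) = (\<Sum>x\<leftarrow>xs. sum_list (f x))"
  by (induction xs) auto

lemma sgn_quotient_of_ints:
  "sgn (of_int a / of_int b :: 'a::linordered_field) = of_int (sgn a * sgn b)"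
  by (auto simp: sgn_if divide_less_0_iff zero_less_divide_iff)

text \<open>The nonvanishing numerators are, up to sign, the potentials at the nodes, by which the modes are normalized.\<close>
locale nondegenerate_two_bridge = two_bridge +
  assumes continuant_nz: "\<And>t. even t \<Longrightarrow> 2 \<le> t \<Longrightarrow> t < n \<Longrightarrow> continuant c t \<noteq> 0"
begin

definition mode_order :: "region list" where
  "mode_order = concat (map (\<lambda>i. map (B i) [1..<nat \<bar>c i\<bar>]) (filter odd [1..<n + 1])) @
                map E (filter even [2..<n])"

lemma set_mode_order: "set mode_order = white_regions D - {E 0}"
proof -
  have "odd i \<Longrightarrow> 1 \<le> i" for i :: nat by (simp add: Suc_leI odd_pos)
  moreover have "even i \<and> i \<noteq> 0 \<Longrightarrow> 2 \<le> i" for i :: nat by (auto elim!: evenE)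
  moreover have "1 \<le> n" using odd_n by (simp add: Suc_leI odd_pos)
  ultimately show ?thesis
    by (auto simp: mode_order_def white_regions_D image_iff)
qed

text \<open>Each mode vanishes on all later regions: ramps stay in their own path and end at their top,
  while the potential modes, whose regions come last, are truncated.\<close>
lemma mode_order_triangular: "sorted_wrt (\<lambda>a b. mode c a b = (0::'a::field_char_0)) mode_order"
proof -
  have "sorted_wrt (\<lambda>a b. mode c a b = (0::'a)) (concat (map (\<lambda>i. map (B i) [1..<nat \<bar>c i\<bar>]) (filter odd [1..<n + 1])))"
    by (rule sorted_wrt_concat_blocks)
       (auto simp: string_mode_def sorted_wrt_map intro!: sorted_wrt_mono_rel[OF _ sorted_wrt_upt])
  moreover have "sorted_wrt (<) (filter even [2..<n])"
    by (intro sorted_wrt_filter sorted_wrt_upt)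
  then have "sorted_wrt (\<lambda>a b. mode c a b = (0::'a)) (map E (filter even [2..<n]))"
    unfolding sorted_wrt_map
    by (rule sorted_wrt_mono_rel[rotated]) (auto simp: interpolation_def truncated_potential_def)
  ultimately show ?thesis
    by (auto simp: mode_order_def sorted_wrt_append string_mode_def)
qed

lemma mode_order_cases:
  assumes "a \<in> set mode_order"
  obtains (string) i k where "a = B i k" "odd i" "1 \<le> i" "i \<le> n" "1 \<le> k" "k < nat \<bar>c i\<bar>"
  | (node) t where "a = E t" "even t" "2 \<le> t" "t < n"
  using assms unfolding mode_order_def by auto

lemma mode_self:
  assumes "a \<in> set mode_order"
  shows "mode c a a = (1::'a::field_char_0)"
  using assms
proof (cases rule: mode_order_cases)
  case (node t)
  then show ?thesis
    using continuant_nz[of t] by (simp add: interpolation_def truncated_potential_def potential_def)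
qed (simp add: string_mode_def)

lemma distinct_mode_order: "distinct mode_order"
proof -
  have "mode_order ! i \<noteq> mode_order ! j" if "i < j" "j < length mode_order" for i j
    using sorted_wrt_nth_less[OF mode_order_triangular[where 'a = rat] that]
      mode_self[of "mode_order ! j", where 'a = rat] that by auto
  then show ?thesis by (metis distinct_conv_nth linorder_neqE_nat)
qed

lemma mode_unbounded: "mode c a (E 0) = 0"
  by (cases a) (simp_all add: string_mode_def interpolation_def truncated_potential_def)

lemma form_of_modes:
  assumes a: "a \<in> set mode_order" and b: "b \<in> set mode_order"
  shows "(\<Sum>l=1..n. twist_term c n (mode c a) (mode c b) l) =
         (if a = b then mode_norm c a else (0::'a::field_char_0))"
proof -
  let ?Q = "\<lambda>a b. \<Sum>l=1..n. twist_term c n (mode c a) (mode c b :: region \<Rightarrow> 'a) l"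
  have comm: "?Q a b = ?Q b a" for a b by (simp add: twist_term_commute)
  have strings: "?Q (B i k) (B i' k') = (if i = i' \<and> k = k' then mode_norm c (B i k) else 0)"
    if i: "odd i" "1 \<le> i" "i \<le> n" and k: "1 \<le> k" "k < nat \<bar>c i\<bar>" "1 \<le> k'" "k' < nat \<bar>c i'\<bar>" "k \<le> k'"
    for i i' k k'
  proof -
    have "?Q (B i k) (B i' k') = (\<Sum>l=1..n. if l = i then (if i = i' \<and> k = k' then mode_norm c (B i k) else 0) else 0)"
    proof (rule sum.cong[OF refl])
      fix l
      show "twist_term c n (mode c (B i k)) (mode c (B i' k')) l =
            (if l = i then (if i = i' \<and> k = k' then mode_norm c (B i k) else 0) else (0::'a))"
      proof (cases "odd l")
        case True
        then show ?thesis unfolding mode.simps(1) twist_term_strings[OF True k(2,1,4,3,5)] by auto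
      next
        case False
        then show ?thesis using i by (auto simp: twist_term_def string_mode_def)
      qed
    qed
    then show ?thesis using i by simp
  qed
  have mixed: "?Q (B i k) (E t) = 0" if "1 \<le> k" "k < nat \<bar>c i\<bar>" "t < n" for i k t
    using that by (intro sum.neutral ballI)
      (auto simp: truncated_potential_def intro!: twist_term_string_interpolation)
  show ?thesis
    using a
  proof (cases rule: mode_order_cases)
    case a: (string i k)
    show ?thesis
      using b
    proof (cases rule: mode_order_cases)
      case b: (string i' k')
      show ?thesis
      proof (cases "k \<le> k'")
        case True
        then show ?thesis using a b strings[of i k k' i'] by simp
      next
        case False
        then show ?thesis using a b strings[of i' k' k i] comm[of a b] by auto
      qed
    next
      case (node t)
      then show ?thesis using a mixed[of k i t] by simp
    qed
  next
    case a: (node t)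
    show ?thesis
      using b
    proof (cases rule: mode_order_cases)
      case (string i k)
      then show ?thesis using a mixed[of k i t] comm[of a b] by simp
    next
      case b: (node t')
      show ?thesis
      proof (cases "t \<le> t'")
        case True
        then show ?thesis
          using a b form_of_potential_modes[of t t', where 'a = 'a] continuant_nz[of t'] by auto
      next
        case False
        then show ?thesis
          using a b form_of_potential_modes[of t' t, where 'a = 'a] continuant_nz[of t] comm[of a b]
          by auto
      qed
    qed
  qed
qed

lemma length_goeritz_basis:
  assumes "goeritz_basis D ws"
  shows "length ws = length mode_order"
  using assms distinct_mode_order unfolding goeritz_basis_def unbounded_D
  by (metis distinct_card set_mode_order)

text \<open>The columns of \<open>P\<close> are the modes, with their values listed in the order \<open>ws\<close>, so the congruent matrix
  is the Gram matrix of the modes for the energy.\<close>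
lemma goeritz_diagonalization:
  assumes ws: "goeritz_basis D ws"
  defines "N \<equiv> length mode_order"
  defines "P \<equiv> mat N N (\<lambda>(r, s). mode c (mode_order ! s) (ws ! r) :: 'a::field_char_0)"
  shows "P \<in> carrier_mat N N" "det P \<in> {1, -1}"
    "transpose_mat P * map_mat of_int (goeritz_matrix D ws) * P = diagonal_of (map (mode_norm c) mode_order)"
proof -
  have dist: "distinct ws" and set: "set ws = set mode_order"
    using ws by (auto simp: goeritz_basis_def set_mode_order)
  have len: "length ws = N" using length_goeritz_basis[OF ws] by (simp add: N_def)
  show P: "P \<in> carrier_mat N N" by (simp add: P_def)
  show "det P \<in> {1, -1}"
    unfolding P_def N_def
    by (rule det_of_unitriangular_family)
       (use dist set distinct_mode_order mode_order_triangular mode_self in auto)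
  let ?G = "map_mat of_int (goeritz_matrix D ws) :: 'a mat"
  have G: "?G \<in> carrier_mat N N" by (simp add: goeritz_matrix_def len)
  have GP: "transpose_mat P * ?G * P \<in> carrier_mat N N" using P G by simp
  have sum_ws: "(\<Sum>r<N. h (ws ! r)) = (\<Sum>a\<in>set ws. h a)" for h :: "region \<Rightarrow> 'a"
    using sum.reindex_bij_betw[OF bij_betw_nth[OF dist refl refl], of h] len by simp
  show "transpose_mat P * ?G * P = diagonal_of (map (mode_norm c) mode_order)"
  proof (rule diagonal_of_eqI)
    fix s t assume "s < length (map (mode_norm c :: region \<Rightarrow> 'a) mode_order)"
      "t < length (map (mode_norm c :: region \<Rightarrow> 'a) mode_order)"
    then have st: "s < N" "t < N" by (simp_all add: N_def)
    let ?a = "mode_order ! s" and ?b = "mode_order ! t"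
    have ab: "?a \<in> set mode_order" "?b \<in> set mode_order" using st by (simp_all add: N_def)
    have "(transpose_mat P * ?G * P) $$ (s, t) =
          (\<Sum>r<N. \<Sum>q<N. mode c ?a (ws ! r) * of_int (goeritz_entry D (ws ! r) (ws ! q)) * mode c ?b (ws ! q))"
      using st by (simp add: congruence_entry[OF P G st]) (simp add: P_def goeritz_matrix_def len)
    also have "\<dots> = (\<Sum>x\<in>set ws. \<Sum>y\<in>set ws. mode c ?a x * of_int (goeritz_entry D x y) * mode c ?b y)"
      by (simp add: sum_ws[of "\<lambda>y. mode c ?a x * of_int (goeritz_entry D x y) * mode c ?b y" for x]
          sum_ws[of "\<lambda>x. \<Sum>y\<in>set ws. mode c ?a x * of_int (goeritz_entry D x y) * mode c ?b y"])
    also have "\<dots> = (\<Sum>l=1..n. twist_term c n (mode c ?a) (mode c ?b) l)"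
      using goeritz_form_D[where \<phi> = "mode c ?a" and \<psi> = "mode c ?b", OF mode_unbounded mode_unbounded]
      by (simp add: set set_mode_order)
    also have "\<dots> = (if ?a = ?b then mode_norm c ?a else 0)"
      by (rule form_of_modes[OF ab])
    finally show "(transpose_mat P * ?G * P) $$ (s, t) =
        (if s = t then map (mode_norm c) mode_order ! s else 0)"
      using st distinct_mode_order by (simp add: N_def nth_eq_iff_index_eq)
  qed (use GP in \<open>simp add: N_def\<close>)
qed

text \<open>Each odd twist region contributes one bigon less than it has crossings, and there is one more odd
  than even twist region.\<close>
lemma length_mode_order:
  "length mode_order = (\<Sum>i | i \<in> {1..n} \<and> odd i. nat \<bar>c i\<bar>) - 1"
proof -
  let ?O = "filter odd [1..<n + 1]"
  obtain m where m: "n = 2 * m + 1" using odd_n by (rule oddE)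
  have "length (filter odd [1..<2 * m + 2]) = Suc m \<and> length (filter even [2..<2 * m + 1]) = m"
    by (induction m) (auto simp: upt_rec[of 2])
  then have len: "length ?O = Suc (length (filter even [2..<n]))" by (simp add: m)
  have "(\<Sum>i\<leftarrow>?O. nat \<bar>c i\<bar>) = (\<Sum>i\<leftarrow>?O. (nat \<bar>c i\<bar> - 1) + 1)"
    using nz by (intro arg_cong[of _ _ sum_list] map_cong refl) force
  also have "\<dots> = (\<Sum>i\<leftarrow>?O. nat \<bar>c i\<bar> - 1) + length ?O"
    by (simp only: sum_list_addf) (simp add: sum_list_triv)
  also have "\<dots> = Suc (length mode_order)"
    unfolding len by (simp add: mode_order_def length_concat comp_def del: upt_Suc)
  also have "(\<Sum>i\<leftarrow>?O. nat \<bar>c i\<bar>) = (\<Sum>i\<in>set ?O. nat \<bar>c i\<bar>)"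
    by (rule sum_list_distinct_conv_sum_set) simp
  also have "set ?O = {i. i \<in> {1..n} \<and> odd i}" by auto
  finally show ?thesis by simp
qed

text \<open>The \<open>\<bar>c\<^sub>i\<bar> - 1\<close> entries of the \<open>i\<close>-th path all have the sign \<open>-\<epsilon>\<^sub>i\<close>, and
  \<open>-\<epsilon>\<^sub>i (\<bar>c\<^sub>i\<bar> - 1) = \<epsilon>\<^sub>i - c\<^sub>i\<close>.\<close>
lemma goeritz_signature:
  assumes ws: "goeritz_basis D ws"
  shows "matrix_signature (map_mat real_of_int (goeritz_matrix D ws)) =
    (\<Sum>i | i \<in> {1..n} \<and> odd i. sgn (c i) - c i) +
    (\<Sum>i | i \<in> {2..n - 1} \<and> even i. sgn (continuant c (i + 2)) * sgn (c (i + 1) * continuant c i))"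
proof -
  let ?G = "map_mat real_of_int (goeritz_matrix D ws)"
  let ?O = "filter odd [1..<n + 1]" and ?V = "filter even [2..<n]"
  let ?s = "\<lambda>i. sgn (continuant c (i + 2)) * sgn (c (i + 1) * continuant c i)"
  note diag = goeritz_diagonalization[OF ws, where 'a = real]
  have "transpose_mat ?G = ?G"
    by (rule eq_matI) (auto simp: goeritz_matrix_def goeritz_entry_commute)
  moreover have "?G \<in> carrier_mat (length mode_order) (length mode_order)"
    by (simp add: goeritz_matrix_def length_goeritz_basis[OF ws])
  ultimately have "real_of_int (matrix_signature ?G) = (\<Sum>d\<leftarrow>map (mode_norm c) mode_order. sgn d)"
    using diag by (intro signature_of_congruent_diagonal) auto
  also have "\<dots> = (\<Sum>i\<leftarrow>?O. \<Sum>k\<leftarrow>[1..<nat \<bar>c i\<bar>]. sgn (mode_norm c (B i k))) + (\<Sum>i\<leftarrow>?V. sgn (mode_norm c (E i)))"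
    by (simp add: mode_order_def map_concat sum_list_concat_map comp_def del: upt_Suc mode_norm.simps)
  also have "(\<Sum>i\<leftarrow>?O. \<Sum>k\<leftarrow>[1..<nat \<bar>c i\<bar>]. sgn (mode_norm c (B i k) :: real)) = (\<Sum>i\<leftarrow>?O. of_int (sgn (c i) - c i))"
  proof (intro arg_cong[of _ _ sum_list] map_cong refl)
    fix i assume "i \<in> set ?O"
    then have c: "c i \<noteq> 0" using nz by auto
    have "(\<Sum>k\<leftarrow>[1..<nat \<bar>c i\<bar>]. sgn (mode_norm c (B i k) :: real)) = (\<Sum>k\<leftarrow>[1..<nat \<bar>c i\<bar>]. - of_int (sgn (c i)))"
      by (intro arg_cong[of _ _ sum_list] map_cong refl) (auto simp: sgn_mult sgn_if divide_less_0_iff)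
    also have "\<dots> = of_int (sgn (c i) - c i)"
      using c by (auto simp: sum_list_triv sgn_if of_nat_diff)
    finally show "(\<Sum>k\<leftarrow>[1..<nat \<bar>c i\<bar>]. sgn (mode_norm c (B i k) :: real)) = of_int (sgn (c i) - c i)" .
  qed
  also have "\<dots> = (\<Sum>i\<in>set ?O. of_int (sgn (c i) - c i))"
    by (rule sum_list_distinct_conv_sum_set) simp
  also have "set ?O = {i. i \<in> {1..n} \<and> odd i}" by auto
  also have "(\<Sum>i\<leftarrow>?V. sgn (mode_norm c (E i) :: real)) = (\<Sum>i\<leftarrow>?V. of_int (?s i))"
    by (simp only: mode_norm.simps sgn_quotient_of_ints)
  also have "\<dots> = (\<Sum>i\<in>set ?V. of_int (?s i))"
    by (rule sum_list_distinct_conv_sum_set) simp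
  also have "set ?V = {i. i \<in> {2..n - 1} \<and> even i}" by auto
  finally show ?thesis by (simp only: flip: of_int_sum of_int_add of_int_eq_iff)
qed

end

theorem theorem1p2:
  fixes c :: "nat \<Rightarrow> int" and n N :: nat and ws :: "region list"
  assumes "odd n"
    and "\<forall>i\<in>{1..n}. c i \<noteq> 0"
    and "\<forall>i\<in>{2..n - 1}. even i \<longrightarrow> cf_numerator c (i - 1) \<noteq> 0"
    and "goeritz_basis (two_bridge_diagram c n) ws"
    and "N = (\<Sum>i | i \<in> {1..n} \<and> odd i. nat \<bar>c i\<bar>) - 1"
  shows "goeritz_matrix (two_bridge_diagram c n) ws \<in> carrier_mat N N \<and>
    (\<exists>P :: rat mat. P \<in> carrier_mat N N \<and> invertible_mat P \<and> (det P = 1 \<or> det P = -1) \<and>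
      transpose_mat P * map_mat rat_of_int (goeritz_matrix (two_bridge_diagram c n) ws) * P =
      diag_block_mat
        (concat (map (\<lambda>i. map (\<lambda>k. block1 (- of_int (sgn (c i)) * (of_nat (k + 1) / of_nat k)))
                              [1..<nat \<bar>c i\<bar>])
                     (filter odd [1..<n + 1]))
         @ map (\<lambda>i. block1 (of_int (cf_numerator c (i + 1)) /
                             of_int (c (i + 1) * cf_numerator c (i - 1))))
               (filter even [2..<n]))) \<and>
    of_int (matrix_signature
           (map_mat real_of_int (goeritz_matrix (two_bridge_diagram c n) ws))) =
      of_int (\<Sum>i | i \<in> {1..n} \<and> odd i. sgn (c i) - c i) +
      (\<Sum>i | i \<in> {2..n - 1} \<and> even i.
         sgn (of_int (cf_numerator c (i + 1)) /
              of_int (c (i + 1) * cf_numerator c (i - 1)) :: rat))"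
proof -
  have num: "cf_numerator c (i + 1) = continuant c (i + 2)" "cf_numerator c (i - 1) = continuant c i"
    if "2 \<le> i" for i
    using that by (simp_all add: cf_numerator_eq_continuant)
  interpret nondegenerate_two_bridge c n
  proof
    fix t assume "even t" "2 \<le> t" "t < n"
    then show "continuant c t \<noteq> 0" using assms(3) num(2)[of t] by auto
  qed (use assms in auto)
  note diag = goeritz_diagonalization[OF assms(4), where 'a = rat]
  let ?P = "mat (length mode_order) (length mode_order) (\<lambda>(r, s). mode c (mode_order ! s) (ws ! r) :: rat)"
  have N: "length mode_order = N" by (simp add: assms(5) length_mode_order)
  have "goeritz_matrix D ws \<in> carrier_mat N N" by (simp add: goeritz_matrix_def length_goeritz_basis[OF assms(4)] N)
  moreover have "invertible_mat ?P"
  proof -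
    have "det ?P \<noteq> 0" using diag(2) by auto
    then obtain Q where "Q \<in> carrier_mat N N" "?P * Q = 1\<^sub>m N" "Q * ?P = 1\<^sub>m N"
      using det_non_zero_imp_unit[OF diag(1), of "()"] by (auto simp: Units_def ring_mat_def N)
    then show ?thesis using N by (auto simp: invertible_mat_def inverts_mat_def)
  qed
  moreover have "map block1 (map (mode_norm c) mode_order :: rat list) =
      concat (map (\<lambda>i. map (\<lambda>k. block1 (- of_int (sgn (c i)) * (of_nat (k + 1) / of_nat k)))
                              [1..<nat \<bar>c i\<bar>]) (filter odd [1..<n + 1]))
         @ map (\<lambda>i. block1 (of_int (cf_numerator c (i + 1)) /
                             of_int (c (i + 1) * cf_numerator c (i - 1)))) (filter even [2..<n])"
  proof -
    have "map (\<lambda>i. block1 (mode_norm c (E i) :: rat)) (filter even [2..<n]) =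
      map (\<lambda>i. block1 (of_int (cf_numerator c (i + 1)) / of_int (c (i + 1) * cf_numerator c (i - 1))))
        (filter even [2..<n])"
    proof (rule map_cong[OF refl])
      fix i assume "i \<in> set (filter even [2..<n])"
      then have "2 \<le> i" by simp
      then show "block1 (mode_norm c (E i) :: rat) =
        block1 (of_int (cf_numerator c (i + 1)) / of_int (c (i + 1) * cf_numerator c (i - 1)))"
        by (simp only: mode_norm.simps num)
    qed
    then show ?thesis
      by (simp only: mode_order_def map_append map_concat map_map comp_def mode_norm.simps(1))
  qed
  moreover have "rat_of_int (matrix_signature (map_mat real_of_int (goeritz_matrix D ws))) =
      of_int (\<Sum>i | i \<in> {1..n} \<and> odd i. sgn (c i) - c i) +
      (\<Sum>i | i \<in> {2..n - 1} \<and> even i.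
         sgn (of_int (cf_numerator c (i + 1)) / of_int (c (i + 1) * cf_numerator c (i - 1)) :: rat))"
    unfolding goeritz_signature[OF assms(4)] of_int_add
    by (rule arg_cong2[of _ _ _ _ "(+)", OF refl])
       (auto simp only: of_int_sum sgn_quotient_of_ints num mem_Collect_eq atLeastAtMost_iff intro!: sum.cong)
  ultimately show ?thesis
    using diag unfolding N by (intro conjI exI[of _ ?P]) (auto simp: N)
qed

end
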